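(* Let $G=(V,E)$ be a directed graph on $n$ vertices with vertex weights $\pi:V\to\mathbb{R}_+$. Then $$\lambda^{\Delta_v}_\pi(G)\lesssim\vec\psi_\pi(G)\lesssim\sqrt{\log n}\cdot\lambda^{\Delta_v}_\pi(G).$$
   Context: For $S\subseteq V$, $\partial^+(S)=\{v\notin S:\exists u\in S,\ uv\in E\}$, $\pi(S)=\sum_{i\in S}\pi(i)$, $\vec\psi_\pi(S)=\frac{\min\{\pi(\partial^+(S)),\pi(\partial^+(\overline S))\}}{\min\{\pi(S),\pi(\overline S)\}}$ and $\vec\psi_\pi(G)=\min_{\emptyset\ne S\subsetneq V}\vec\psi_\pi(S)$. $\mathcal F_v(G)$ is the set of $F:E\to\mathbb{R}_{\ge0}$ with $\sum_{j:ij\in E}F(i,j)=\sum_{j:ji\in E}F(j,i)\le\pi(i)$ for all $i\in V$. Define $$\lambda^{\Delta_v}_\pi(G)=\min_{v_1,\dots,v_n\in\mathbb{R}^n}\max_{F\in\mathcal F_v(G)}\tfrac12\sum_{ij\in E}F(i,j)\|v_i-v_j\|^2$$ subject to $\sum_i\pi(i)v_i=0$, $\sum_i\pi(i)\|v_i\|^2=1$, and $\|v_i-v_j\|^2+\|v_j-v_k\|^2\ge\|v_i-v_k\|^2$ for all $i,j,k\in V$. $\lesssim$ hides an absolute constant. *)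

theory Defs
  imports Complex_Main
begin

text \<open>Directed graph: finite vertex set V :: nat set, arc set E \<subseteq> V \<times> V,
  vertex weights w :: nat \<Rightarrow> real. Vectors in R^n (n = card V) are
  functions nat \<Rightarrow> real of which only the coordinates k < n matter.\<close>

definition wt :: "(nat \<Rightarrow> real) \<Rightarrow> nat set \<Rightarrow> real" where
  "wt w S = (\<Sum>i\<in>S. w i)"

definition out_bd :: "nat set \<Rightarrow> (nat \<times> nat) set \<Rightarrow> nat set \<Rightarrow> nat set" where
  "out_bd V E S = {v \<in> V. v \<notin> S \<and> (\<exists>u\<in>S. (u, v) \<in> E)}"

definition psi_set :: "nat set \<Rightarrow> (nat \<times> nat) set \<Rightarrow> (nat \<Rightarrow> real) \<Rightarrow> nat set \<Rightarrow> real" where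
  "psi_set V E w S =
     min (wt w (out_bd V E S)) (wt w (out_bd V E (V - S))) / min (wt w S) (wt w (V - S))"

definition psi_graph :: "nat set \<Rightarrow> (nat \<times> nat) set \<Rightarrow> (nat \<Rightarrow> real) \<Rightarrow> real" where
  "psi_graph V E w = Min (psi_set V E w ` {S. S \<subseteq> V \<and> S \<noteq> {} \<and> S \<noteq> V})"

definition sqdist :: "nat \<Rightarrow> (nat \<Rightarrow> real) \<Rightarrow> (nat \<Rightarrow> real) \<Rightarrow> real" where
  "sqdist n x y = (\<Sum>k<n. (x k - y k)\<^sup>2)"

definition sqnorm :: "nat \<Rightarrow> (nat \<Rightarrow> real) \<Rightarrow> real" where
  "sqnorm n x = (\<Sum>k<n. (x k)\<^sup>2)"

definition flows_v :: "nat set \<Rightarrow> (nat \<times> nat) set \<Rightarrow> (nat \<Rightarrow> real) \<Rightarrow> (nat \<times> nat \<Rightarrow> real) set" where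
  "flows_v V E w = {F. (\<forall>e\<in>E. F e \<ge> 0) \<and>
     (\<forall>i\<in>V. (\<Sum>j\<in>{j. (i, j) \<in> E}. F (i, j)) = (\<Sum>j\<in>{j. (j, i) \<in> E}. F (j, i))
           \<and> (\<Sum>j\<in>{j. (i, j) \<in> E}. F (i, j)) \<le> w i)}"

definition embeddings :: "nat set \<Rightarrow> (nat \<Rightarrow> real) \<Rightarrow> (nat \<Rightarrow> nat \<Rightarrow> real) set" where
  "embeddings V w = {v. let n = card V in
     (\<forall>k<n. (\<Sum>i\<in>V. w i * v i k) = 0) \<and>
     (\<Sum>i\<in>V. w i * sqnorm n (v i)) = 1 \<and>
     (\<forall>i\<in>V. \<forall>j\<in>V. \<forall>k\<in>V. sqdist n (v i) (v j) + sqdist n (v j) (v k) \<ge> sqdist n (v i) (v k))}"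

definition flow_energy :: "nat set \<Rightarrow> (nat \<times> nat) set \<Rightarrow> (nat \<times> nat \<Rightarrow> real) \<Rightarrow> (nat \<Rightarrow> nat \<Rightarrow> real) \<Rightarrow> real" where
  "flow_energy V E F v = (1/2) * (\<Sum>(i, j)\<in>E. F (i, j) * sqdist (card V) (v i) (v j))"

definition lambda_v :: "nat set \<Rightarrow> (nat \<times> nat) set \<Rightarrow> (nat \<Rightarrow> real) \<Rightarrow> real" where
  "lambda_v V E w = (INF v\<in>embeddings V w. SUP F\<in>flows_v V E w. flow_energy V E F v)"

end

theory Submission
  imports Defs "HOL-Analysis.Analysis"
begin

text \<open>The lower bound on \<open>psi_graph\<close> uses the two-valued embedding of an optimal cut.

  For the upper bound, linear programming duality turns the maximal flow energy of an embedding into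
  vertex costs \<open>r\<close> and a potential \<open>p\<close> with \<open>d(i,j)/2 + p j - p i \<le> r j\<close> on every arc, where \<open>d\<close> is
  the squared distance. If \<open>\<delta> j \<le> d(i,j)\<close> for all \<open>i\<close> in a set \<open>A\<close>, sweeping over the distance from
  the low-potential half of \<open>A\<close> (or to the high-potential half) in the quasimetric
  \<open>d(i,j)/2 + p j - p i\<close> finds a cut of expansion at most
  \<open>sum (w r) / (w(A) * sum (w \<delta>))\<close>, up to normalisation.

  It remains to find \<open>A\<close> and \<open>\<delta>\<close> with \<open>w(A) * sum (w \<delta>)\<close> at least of order \<open>1 / sqrt (ln n)\<close> (the
  Arora--Rao--Vazirani theorem). Project on a uniformly random sign vector \<open>e\<close>, and match points of low
  projection with points of high projection at squared distance at most \<open>\<Delta>\<close>. If the maximal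
  matching never leaves two large separated sets, then the mean of the largest projection
  \<open>\<langle>e, u j - u i\<rangle>\<close> over \<open>d(i,j) \<le> k \<Delta>\<close> grows by a constant with every \<open>k\<close>: the loss in following
  matched pairs is only a standard deviation, which Efron--Stein bounds by \<open>sqrt (2 k \<Delta>)\<close>. After
  more than \<open>sqrt (ln n)\<close> steps this exceeds the sub-Gaussian bound for a maximum of \<open>n\<close>
  projections.\<close>

subsection \<open>Averages over the sign cube\<close>

text \<open>The expectation over independent uniform signs in the coordinates below
  \<open>n\<close>, all later coordinates being 0. Splitting on the last sign lets moment bounds go
  by induction on the dimension.\<close>

primrec cube_avg :: "nat \<Rightarrow> ((nat \<Rightarrow> real) \<Rightarrow> real) \<Rightarrow> real" where
  "cube_avg 0 h = h (\<lambda>_. 0)"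
| "cube_avg (Suc n) h = (cube_avg n (\<lambda>e. h (e(n := 1))) + cube_avg n (\<lambda>e. h (e(n := -1)))) / 2"

definition dotp :: "nat \<Rightarrow> (nat \<Rightarrow> real) \<Rightarrow> (nat \<Rightarrow> real) \<Rightarrow> real" where
  "dotp n e x = (\<Sum>k<n. e k * x k)"

lemma cube_avg_const [simp]: "cube_avg n (\<lambda>_. c) = c"
  by (induction n) auto

lemma cube_avg_add: "cube_avg n (\<lambda>e. f e + g e) = cube_avg n f + cube_avg n g"
  by (induction n arbitrary: f g) (auto simp: field_simps)

lemma cube_avg_cmult: "cube_avg n (\<lambda>e. c * f e) = c * cube_avg n f"
  by (induction n arbitrary: f) (auto simp: field_simps)

lemma cube_avg_diff: "cube_avg n (\<lambda>e. f e - g e) = cube_avg n f - cube_avg n g"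
  using cube_avg_add[of n f "\<lambda>e. (-1) * g e"] cube_avg_cmult[of n "-1" g] by simp

lemma cube_avg_sum: "cube_avg n (\<lambda>e. \<Sum>i\<in>I. f i e) = (\<Sum>i\<in>I. cube_avg n (f i))"
  by (induction I rule: infinite_finite_induct) (auto simp: cube_avg_add)

lemma cube_avg_mono: "(\<And>e. f e \<le> g e) \<Longrightarrow> cube_avg n f \<le> cube_avg n g"
  by (induction n arbitrary: f g) (auto intro!: add_mono divide_right_mono)

lemma cube_avg_reflect: "cube_avg n (\<lambda>e. h (\<lambda>k. - e k)) = cube_avg n h"
proof (induction n arbitrary: h)
  case (Suc n)
  have "(\<lambda>k. - (e(n := c)) k) = (\<lambda>k. - e k)(n := - c)" for e and c :: real by auto
  then show ?case using Suc[of "\<lambda>e. h (e(n := -1))"] Suc[of "\<lambda>e. h (e(n := 1))"] by simp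
qed simp

text \<open>Overwriting one sign by a fresh uniform sign does not change the distribution. This
  turns sums over both values of a coordinate back into plain averages.\<close>

lemma cube_avg_resample:
  "i < n \<Longrightarrow> cube_avg n (\<lambda>e. g (e(i := 1)) + g (e(i := -1))) = 2 * cube_avg n g"
proof (induction n arbitrary: g)
  case (Suc n)
  show ?case
  proof (cases "i = n")
    case True
    show ?thesis unfolding True by (simp only: cube_avg.simps fun_upd_upd cube_avg_add) simp
  next
    case False
    then have "i < n" using Suc.prems by simp
    have twist: "e(n := c, i := d) = e(i := d, n := c)" for c d and e :: "nat \<Rightarrow> real"
      using False by (simp add: fun_upd_twist)
    show ?thesis
      using Suc.IH[OF \<open>i < n\<close>, of "\<lambda>e. g (e(n := 1))"] Suc.IH[OF \<open>i < n\<close>, of "\<lambda>e. g (e(n := -1))"]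
      unfolding cube_avg.simps twist by argo
  qed
qed simp

lemma cube_avg_square_le: "(cube_avg n f)\<^sup>2 \<le> cube_avg n (\<lambda>e. (f e)\<^sup>2)"
proof -
  let ?m = "cube_avg n f"
  have "0 \<le> cube_avg n (\<lambda>e. (f e - ?m)\<^sup>2)"
    using cube_avg_mono[of "\<lambda>_. 0" "\<lambda>e. (f e - ?m)\<^sup>2" n] by simp
  also have "(\<lambda>e. (f e - ?m)\<^sup>2) = (\<lambda>e. (f e)\<^sup>2 - (2 * ?m) * f e + ?m\<^sup>2)"
    by (auto simp: power2_eq_square algebra_simps)
  finally show ?thesis
    by (simp add: cube_avg_add cube_avg_diff cube_avg_cmult power2_eq_square)
qed

lemma dotp_upd_ge [simp]: "n \<le> i \<Longrightarrow> dotp n (e(i := c)) x = dotp n e x"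
  unfolding dotp_def by (intro sum.cong) auto

lemma dotp_Suc: "dotp (Suc n) e x = dotp n e x + e n * x n"
  by (simp add: dotp_def)

lemma dotp_diff: "dotp n e (\<lambda>k. x k - y k) = dotp n e x - dotp n e y"
  by (simp add: dotp_def algebra_simps sum_subtractf)

lemma dotp_uminus: "dotp n (\<lambda>k. - e k) x = - dotp n e x"
  by (simp add: dotp_def sum_negf)

lemma cube_avg_dotp_sq: "cube_avg n (\<lambda>e. (dotp n e x)\<^sup>2) = sqnorm n x"
proof (induction n)
  case 0
  then show ?case by (simp add: dotp_def sqnorm_def)
next
  case (Suc n)
  have "cube_avg (Suc n) (\<lambda>e. (dotp (Suc n) e x)\<^sup>2)
      = (cube_avg n (\<lambda>e. (dotp n e x + x n)\<^sup>2) + cube_avg n (\<lambda>e. (dotp n e x - x n)\<^sup>2)) / 2"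
    by (simp add: dotp_Suc)
  also have "\<dots> = cube_avg n (\<lambda>e. (dotp n e x + x n)\<^sup>2 + (dotp n e x - x n)\<^sup>2) / 2"
    by (simp add: cube_avg_add)
  also have "(\<lambda>e. (dotp n e x + x n)\<^sup>2 + (dotp n e x - x n)\<^sup>2)
      = (\<lambda>e. 2 * (dotp n e x)\<^sup>2 + 2 * (x n)\<^sup>2)"
    by (auto simp: power2_eq_square algebra_simps)
  finally show ?case using Suc by (simp add: cube_avg_add cube_avg_cmult sqnorm_def)
qed

text \<open>Odd powers of the new sign cancel; raising the coefficient of the remaining fourth power
  from 1 to 3 then completes the square.\<close>

lemma cube_avg_dotp_pow4: "cube_avg n (\<lambda>e. (dotp n e x) ^ 4) \<le> 3 * (sqnorm n x)\<^sup>2"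
proof (induction n)
  case 0
  then show ?case by (simp add: dotp_def sqnorm_def)
next
  case (Suc n)
  have "cube_avg (Suc n) (\<lambda>e. (dotp (Suc n) e x) ^ 4)
      = (cube_avg n (\<lambda>e. (dotp n e x + x n) ^ 4) + cube_avg n (\<lambda>e. (dotp n e x - x n) ^ 4)) / 2"
    by (simp add: dotp_Suc)
  also have "\<dots> = cube_avg n (\<lambda>e. (dotp n e x + x n) ^ 4 + (dotp n e x - x n) ^ 4) / 2"
    by (simp add: cube_avg_add)
  also have "(\<lambda>e. (dotp n e x + x n) ^ 4 + (dotp n e x - x n) ^ 4)
      = (\<lambda>e. 2 * (dotp n e x) ^ 4 + (12 * (x n)\<^sup>2) * (dotp n e x)\<^sup>2 + 2 * (x n) ^ 4)"
    by (auto simp: power2_eq_square power4_eq_xxxx algebra_simps)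
  finally have "cube_avg (Suc n) (\<lambda>e. (dotp (Suc n) e x) ^ 4)
      = cube_avg n (\<lambda>e. (dotp n e x) ^ 4) + 6 * (x n)\<^sup>2 * sqnorm n x + (x n) ^ 4"
    by (simp add: cube_avg_add cube_avg_cmult cube_avg_dotp_sq)
  also have "\<dots> \<le> 3 * (sqnorm n x)\<^sup>2 + 6 * (x n)\<^sup>2 * sqnorm n x + 3 * (x n) ^ 4"
    using Suc by (intro add_mono) auto
  also have "\<dots> = 3 * (sqnorm n x + (x n)\<^sup>2)\<^sup>2"
    by (simp add: power2_eq_square power4_eq_xxxx algebra_simps)
  finally show ?case by (simp add: sqnorm_def)
qed

lemma sqnorm_nonneg: "0 \<le> sqnorm n x"
  by (simp add: sqnorm_def sum_nonneg)

text \<open>Averaging \<open>y \<ge> y\<^sup>2 - y^4 / 6\<close> at \<open>y = \<bar>dotp n e x\<bar> / norm x\<close>.\<close>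
lemma cube_avg_abs_dotp: "sqrt (sqnorm n x) / 2 \<le> cube_avg n (\<lambda>e. \<bar>dotp n e x\<bar>)"
proof (cases "sqnorm n x = 0")
  case True
  then show ?thesis
    using cube_avg_mono[of "\<lambda>_. 0" "\<lambda>e. \<bar>dotp n e x\<bar>" n] by simp
next
  case False
  define s where "s = sqrt (sqnorm n x)"
  have s: "s > 0" "s\<^sup>2 = sqnorm n x"
    using False sqnorm_nonneg[of n x] by (auto simp: s_def)
  have pt: "y\<^sup>2 - y ^ 4 / 6 \<le> y" if "y \<ge> 0" for y :: real
  proof -
    have "0 \<le> y ^ 3 - 6 * y + 6"
    proof -
      \<comment> \<open>On \<open>y \<ge> 0\<close> the cubic is smallest at \<open>sqrt 2\<close>,
        whence the double root there.\<close>
      have "0 \<le> (y + 2 * sqrt 2) * (y - sqrt 2)\<^sup>2" using that by simp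
      also have "\<dots> = y ^ 3 - 6 * y + 4 * sqrt 2"
        by (simp add: power2_eq_square power3_eq_cube algebra_simps)
      also have "4 * sqrt 2 \<le> 6" 
        using real_le_lsqrt[of "3/2" 2] by (simp add: power2_eq_square)
      finally show ?thesis by simp
    qed
    then have "0 \<le> y * (y ^ 3 - 6 * y + 6)" using that by simp
    then show ?thesis by (simp add: power2_eq_square power3_eq_cube power4_eq_xxxx algebra_simps)
  qed
  have "(1 / s) * (dotp n e x)\<^sup>2 - (1 / (6 * s ^ 3)) * (dotp n e x) ^ 4 \<le> \<bar>dotp n e x\<bar>" for e
  proof -
    have "s * ((\<bar>dotp n e x\<bar> / s)\<^sup>2 - (\<bar>dotp n e x\<bar> / s) ^ 4 / 6) \<le> s * (\<bar>dotp n e x\<bar> / s)"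
      using s by (intro mult_left_mono pt) auto
    moreover have "s * ((\<bar>dotp n e x\<bar> / s)\<^sup>2 - (\<bar>dotp n e x\<bar> / s) ^ 4 / 6)
       = (1 / s) * (dotp n e x)\<^sup>2 - (1 / (6 * s ^ 3)) * (dotp n e x) ^ 4"
      using s(1) by (simp add: power_divide right_diff_distrib)
        (simp add: field_simps power2_eq_square power3_eq_cube power4_eq_xxxx)
    ultimately show ?thesis using s(1) by simp
  qed
  then have "cube_avg n (\<lambda>e. (1 / s) * (dotp n e x)\<^sup>2 - (1 / (6 * s ^ 3)) * (dotp n e x) ^ 4)
      \<le> cube_avg n (\<lambda>e. \<bar>dotp n e x\<bar>)" by (rule cube_avg_mono)
  then have "(1 / s) * s\<^sup>2 - (1 / (6 * s ^ 3)) * cube_avg n (\<lambda>e. (dotp n e x) ^ 4)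
      \<le> cube_avg n (\<lambda>e. \<bar>dotp n e x\<bar>)"
    unfolding cube_avg_diff cube_avg_cmult cube_avg_dotp_sq s(2) .
  \<comment> \<open>Of the main term \<open>s\<close>, the fourth moment takes away at most
    \<open>s / 2\<close>.\<close>
  moreover have "(1 / (6 * s ^ 3)) * cube_avg n (\<lambda>e. (dotp n e x) ^ 4) \<le> (1 / (6 * s ^ 3)) * (3 * (s\<^sup>2)\<^sup>2)"
    using cube_avg_dotp_pow4[of n x] s by (intro mult_left_mono) auto
  moreover have "(1 / (6 * s ^ 3)) * (3 * (s\<^sup>2)\<^sup>2) = s / 2" "(1 / s) * s\<^sup>2 = s"
    using s(1) by (auto simp: field_simps power2_eq_square power3_eq_cube)
  ultimately show ?thesis unfolding s_def[symmetric] by linarith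
qed

section \<open>Variance of a maximum of projections\<close>

text \<open>Condition on the last sign: the variance is the mean of the two conditional variances
  plus a quarter of the squared difference of the conditional means. Induction handles the former,
  and Jensen moves the latter square inside the average.\<close>

lemma cube_efron_stein:
  "cube_avg n (\<lambda>e. (h e)\<^sup>2) - (cube_avg n h)\<^sup>2
     \<le> (\<Sum>i<n. cube_avg n (\<lambda>e. (h (e(i := 1)) - h (e(i := -1)))\<^sup>2)) / 4"
proof (induction n arbitrary: h)
  case (Suc n)
  define p where "p = (\<lambda>e. h (e(n := 1)))"
  define q where "q = (\<lambda>e. h (e(n := -1)))"
  let ?D = "\<lambda>m f i. cube_avg m (\<lambda>e. (f (e(i := 1)) - f (e(i := -1)))\<^sup>2)"
  have tw: "?D (Suc n) h i = (?D n p i + ?D n q i) / 2" if "i < n" for i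
    using that by (simp add: p_def q_def fun_upd_twist)
  have last: "?D (Suc n) h n = cube_avg n (\<lambda>e. (p e - q e)\<^sup>2)"
    by (simp add: p_def q_def)
  have f1: "(cube_avg n p - cube_avg n q)\<^sup>2 \<le> ?D (Suc n) h n"
    unfolding last cube_avg_diff[symmetric] by (rule cube_avg_square_le)
  have f2: "(\<Sum>i<n. ?D (Suc n) h i) = ((\<Sum>i<n. ?D n p i) + (\<Sum>i<n. ?D n q i)) / 2"
  proof -
    have "(\<Sum>i<n. ?D (Suc n) h i) = (\<Sum>i<n. (?D n p i + ?D n q i) / 2)"
      by (intro sum.cong refl tw) simp
    then show ?thesis by (simp only: sum.distrib sum_divide_distrib[symmetric])
  qed
  have f3: "cube_avg (Suc n) (\<lambda>e. (h e)\<^sup>2) - (cube_avg (Suc n) h)\<^sup>2 =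
      ((cube_avg n (\<lambda>e. (p e)\<^sup>2) - (cube_avg n p)\<^sup>2) + (cube_avg n (\<lambda>e. (q e)\<^sup>2) - (cube_avg n q)\<^sup>2)) / 2
      + (cube_avg n p - cube_avg n q)\<^sup>2 / 4"
    by (simp add: p_def q_def power2_eq_square field_simps)
  have f4: "(\<Sum>i<Suc n. ?D (Suc n) h i) = (\<Sum>i<n. ?D (Suc n) h i) + ?D (Suc n) h n"
    by (rule sum.lessThan_Suc)
  have arith: "v \<le> t / 4" if "x \<le> d" "s = (a + b) / 2" "v = (y + z) / 2 + x / 4" "t = s + d"
    "y \<le> a / 4" "z \<le> b / 4" for v t x d s a b y z :: real
    using that by argo
  show ?case by (rule arith[OF f1 f2 f3 f4 Suc[of p] Suc[of q]])
qed simp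

text \<open>A maximiser at either end of a sign flip still competes at the other end, so the flip
  changes the maximum by at most twice a coordinate of one of the two maximisers. Summed over
  coordinates, this costs only the squared norm of a maximiser, however many points there
  are.\<close>

lemma cube_variance_Max_le:
  assumes "finite I" "I \<noteq> {}" and le: "\<And>i. i \<in> I \<Longrightarrow> sqnorm n (x i) \<le> s"
  defines "h \<equiv> \<lambda>e. Max ((\<lambda>i. dotp n e (x i)) ` I)"
  shows "cube_avg n (\<lambda>e. (h e)\<^sup>2) - (cube_avg n h)\<^sup>2 \<le> 2 * s"
proof -
  have "\<exists>i\<in>I. h e = dotp n e (x i)" for e
  proof -
    have "h e \<in> (\<lambda>i. dotp n e (x i)) ` I"
      unfolding h_def using assms(1,2) by (intro Max_in) auto
    then show ?thesis by auto
  qed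
  then obtain m where m: "\<And>e. m e \<in> I" "\<And>e. h e = dotp n e (x (m e))" by metis
  have ge: "dotp n e (x i) \<le> h e" if "i \<in> I" for i e
    unfolding h_def using that assms(1) by (intro Max_ge) auto
  have dotp_flip: "dotp n (e(i := c)) y - dotp n (e(i := d)) y = (c - d) * y i" if "i < n" for e y i c d
  proof -
    have "dotp n (e(i := c)) y - dotp n (e(i := d)) y = (\<Sum>k<n. if k = i then (c - d) * y i else 0)"
      unfolding dotp_def sum_subtractf[symmetric] by (intro sum.cong) (auto simp: algebra_simps)
    then show ?thesis using that by simp
  qed
  let ?g = "\<lambda>i e. 4 * (x (m e) i)\<^sup>2"
  have flip: "(h (e(i := 1)) - h (e(i := -1)))\<^sup>2 \<le> ?g i (e(i := 1)) + ?g i (e(i := -1))" if "i < n" for i e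
  proof -
    let ?a = "e(i := 1)" and ?b = "e(i := -1)"
    have "h ?a - h ?b \<le> 2 * x (m ?a) i"
      using ge[OF m(1)[of ?a], of ?b] dotp_flip[OF that, of e 1 "x (m ?a)" "-1"] m(2)[of ?a] by simp
    moreover have "h ?b - h ?a \<le> - 2 * x (m ?b) i"
      using ge[OF m(1)[of ?b], of ?a] dotp_flip[OF that, of e 1 "x (m ?b)" "-1"] m(2)[of ?b] by simp
    ultimately have "\<bar>h ?a - h ?b\<bar> \<le> \<bar>2 * x (m ?a) i\<bar> \<or> \<bar>h ?a - h ?b\<bar> \<le> \<bar>2 * x (m ?b) i\<bar>"
      by linarith
    then have "(h ?a - h ?b)\<^sup>2 \<le> (2 * x (m ?a) i)\<^sup>2 \<or> (h ?a - h ?b)\<^sup>2 \<le> (2 * x (m ?b) i)\<^sup>2"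
      by (simp only: abs_le_square_iff)
    then show ?thesis
      by (auto simp: power_mult_distrib intro: order_trans)
  qed
  have "(\<Sum>i<n. cube_avg n (\<lambda>e. (h (e(i := 1)) - h (e(i := -1)))\<^sup>2))
      \<le> (\<Sum>i<n. cube_avg n (\<lambda>e. ?g i (e(i := 1)) + ?g i (e(i := -1))))"
    by (intro sum_mono cube_avg_mono flip) simp
  also have "\<dots> = (\<Sum>i<n. 2 * cube_avg n (?g i))"
    by (intro sum.cong refl cube_avg_resample) simp
  also have "\<dots> = 8 * cube_avg n (\<lambda>e. sqnorm n (x (m e)))"
    by (simp add: cube_avg_cmult cube_avg_sum sqnorm_def sum_distrib_left)
  also have "\<dots> \<le> 8 * s"
    using cube_avg_mono[of "\<lambda>e. sqnorm n (x (m e))" "\<lambda>_. s" n] le[OF m(1)] by simp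
  finally show ?thesis using cube_efron_stein[of n h] by linarith
qed

section \<open>Sub-Gaussian bound for a maximum of projections\<close>

text \<open>Termwise comparison of power series, by
  \<open>2 ^ k * fact k \<le> fact (2 * k)\<close>.\<close>

lemma cosh_le_exp_half_square:
  fixes x :: real
  shows "(exp x + exp (- x)) / 2 \<le> exp (x\<^sup>2 / 2)"
proof -
  let ?f = "\<lambda>n. if even n then x ^ n /\<^sub>R fact n else 0"
  have cosh: "(\<lambda>k. ?f (2 * k)) sums cosh x"
    using cosh_converges[of x] by (subst sums_mono_reindex) (auto simp: strict_mono_def dvd_def image_iff)
  have fact: "2 ^ k * fact k \<le> (fact (2 * k) :: real)" for k
  proof (induction k)
    case (Suc k)
    have "2 ^ Suc k * fact (Suc k) = (2 * real (Suc k)) * (2 ^ k * fact k)" by simp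
    also have "\<dots> \<le> (2 * real (Suc k) * real (2 * k + 1)) * fact (2 * k)"
      using Suc by (intro mult_mono) auto
    also have "\<dots> = fact (2 * Suc k)" by (simp add: algebra_simps)
    finally show ?case .
  qed simp
  have "?f (2 * k) \<le> (x\<^sup>2 / 2) ^ k /\<^sub>R fact k" for k
  proof -
    have "x ^ (2 * k) / fact (2 * k) \<le> x ^ (2 * k) / (2 ^ k * fact k)"
      using fact[of k] by (intro divide_left_mono) (auto simp: power_mult)
    moreover have "(x\<^sup>2 / 2) ^ k /\<^sub>R fact k = x ^ (2 * k) / (2 ^ k * fact k)"
      by (simp add: power_mult divide_simps)
    moreover have "?f (2 * k) = x ^ (2 * k) / fact (2 * k)"
      by (simp add: divide_real_def)
    ultimately show ?thesis by (simp only:)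
  qed
  then have "cosh x \<le> exp (x\<^sup>2 / 2)" by (rule sums_le[OF _ cosh exp_converges])
  then show ?thesis by (simp add: cosh_def)
qed

text \<open>By independence the exponential moment is a product of factors
  \<open>cosh (x k)\<close>.\<close>

lemma cube_avg_exp_dotp: "cube_avg n (\<lambda>e. exp (dotp n e x)) \<le> exp (sqnorm n x / 2)"
proof (induction n)
  case 0
  then show ?case by (simp add: dotp_def sqnorm_def)
next
  case (Suc n)
  have "cube_avg (Suc n) (\<lambda>e. exp (dotp (Suc n) e x))
      = cube_avg n (\<lambda>e. ((exp (x n) + exp (- x n)) / 2) * exp (dotp n e x))"
    unfolding cube_avg_cmult by (simp add: dotp_Suc exp_add cube_avg_cmult mult.commute[of "exp (dotp _ _ _)"] exp_diff exp_minus)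
      (simp add: cube_avg_cmult[of n "exp (x n)"] cube_avg_cmult[of n "inverse (exp (x n))"] divide_inverse algebra_simps)
  also have "\<dots> \<le> exp ((x n)\<^sup>2 / 2) * exp (sqnorm n x / 2)"
    unfolding cube_avg_cmult
    using Suc cosh_le_exp_half_square[of "x n"] cube_avg_mono[of "\<lambda>_. 0" "\<lambda>e. exp (dotp n e x)" n]
    by (intro mult_mono) auto
  finally show ?case by (simp add: sqnorm_def exp_add[symmetric] add_divide_distrib add.commute)
qed

text \<open>The exponential of the maximum is at most the sum of the exponentials. Linearising by
  \<open>1 + y \<le> exp y\<close> replaces Jensen's inequality for \<open>exp\<close>. The
  parameter \<open>t\<close> stays free, to be balanced by the caller.\<close>

lemma cube_avg_Max_le:
  assumes I: "finite I" "I \<noteq> {}" and le: "\<And>i. i \<in> I \<Longrightarrow> sqnorm n (x i) \<le> s" and t: "t > 0"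
  shows "cube_avg n (\<lambda>e. Max ((\<lambda>i. dotp n e (x i)) ` I)) \<le> ln (card I) / t + t * s / 2"
proof -
  define h where "h = (\<lambda>e. Max ((\<lambda>i. dotp n e (x i)) ` I))"
  \<comment> \<open>The logarithm of the bound on the expected sum of exponentials, so that this sum
    scaled by \<open>exp (- a)\<close> averages to at most 1.\<close>
  define a where "a = ln (card I) + t\<^sup>2 * s / 2"
  have pos: "real (card I) > 0" using I by (simp add: card_gt_0_iff)
  have pt: "t * h e \<le> a - 1 + exp (- a) * (\<Sum>i\<in>I. exp (dotp n e (\<lambda>k. t * x i k)))" for e
  proof -
    have "h e \<in> (\<lambda>i. dotp n e (x i)) ` I"
      unfolding h_def using I by (intro Max_in) auto
    then obtain i where i: "i \<in> I" "h e = dotp n e (x i)" by auto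
    have "1 + (t * h e - a) \<le> exp (t * h e - a)" by (rule exp_ge_add_one_self)
    also have "\<dots> = exp (- a) * exp (dotp n e (\<lambda>k. t * x i k))"
      by (simp add: i dotp_def sum_distrib_left exp_add[symmetric] algebra_simps)
    also have "\<dots> \<le> exp (- a) * (\<Sum>i\<in>I. exp (dotp n e (\<lambda>k. t * x i k)))"
      using i I by (intro mult_left_mono member_le_sum) auto
    finally show ?thesis by simp
  qed
  have sq: "sqnorm n (\<lambda>k. t * x i k) = t\<^sup>2 * sqnorm n (x i)" for i
    by (simp add: sqnorm_def power_mult_distrib sum_distrib_left)
  have "(\<Sum>i\<in>I. cube_avg n (\<lambda>e. exp (dotp n e (\<lambda>k. t * x i k)))) \<le> (\<Sum>i\<in>I. exp (t\<^sup>2 * s / 2))"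
  proof (intro sum_mono)
    fix i assume "i \<in> I"
    have "cube_avg n (\<lambda>e. exp (dotp n e (\<lambda>k. t * x i k))) \<le> exp (t\<^sup>2 * sqnorm n (x i) / 2)"
      using cube_avg_exp_dotp[of n "\<lambda>k. t * x i k"] by (simp add: sq)
    also have "\<dots> \<le> exp (t\<^sup>2 * s / 2)" using le[OF \<open>i \<in> I\<close>] by (simp add: mult_left_mono)
    finally show "cube_avg n (\<lambda>e. exp (dotp n e (\<lambda>k. t * x i k))) \<le> exp (t\<^sup>2 * s / 2)" .
  qed
  also have "\<dots> = exp a" using pos by (simp add: a_def exp_add)
  finally have "exp (- a) * (\<Sum>i\<in>I. cube_avg n (\<lambda>e. exp (dotp n e (\<lambda>k. t * x i k)))) \<le> 1"
    by (simp add: exp_minus divide_simps)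
  then have "cube_avg n (\<lambda>e. t * h e) \<le> a"
    using cube_avg_mono[of "\<lambda>e. t * h e" _ n, OF pt]
    by (simp add: cube_avg_add cube_avg_cmult cube_avg_sum)
  then have "cube_avg n h \<le> a / t" using t by (simp add: cube_avg_cmult field_simps)
  also have "a / t = ln (card I) / t + t * s / 2"
    using t by (simp add: a_def field_simps power2_eq_square)
  finally show ?thesis by (simp add: h_def)
qed

subsection \<open>Maximal fractional matchings\<close>

text \<open>Greedy construction, one edge at a time: push the smaller residual capacity of the two
  ends, which saturates one of them. Saturated vertices stay saturated, because loads only grow and
  never exceed \<open>P\<close>.\<close>

lemma maximal_fractional_matching:
  fixes P :: "'a \<Rightarrow> real"
  assumes "finite V" "finite H" "H \<subseteq> V \<times> V" "\<And>u. (u, u) \<notin> H" "\<And>u. u \<in> V \<Longrightarrow> P u \<ge> 0"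
  shows "\<exists>g. (\<forall>u w. g u w \<ge> 0) \<and> (\<forall>u w. (u, w) \<notin> H \<longrightarrow> g u w = 0) \<and>
    (\<forall>u\<in>V. (\<Sum>w\<in>V. g u w + g w u) \<le> P u) \<and>
    (\<forall>(u, w)\<in>H. (\<Sum>z\<in>V. g u z + g z u) = P u \<or> (\<Sum>z\<in>V. g w z + g z w) = P w)"
  using assms(2,3,4)
proof (induction H rule: finite_induct)
  case empty
  then show ?case using assms(5) by (intro exI[of _ "\<lambda>_ _. 0"]) auto
next
  case (insert ab H)
  obtain a b where ab: "ab = (a, b)" by force
  have V: "a \<in> V" "b \<in> V" and ne: "a \<noteq> b" using insert.prems ab by auto
  obtain g where g: "\<And>u w. g u w \<ge> 0" "\<And>u w. (u, w) \<notin> H \<Longrightarrow> g u w = 0"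
    "\<And>u. u \<in> V \<Longrightarrow> (\<Sum>w\<in>V. g u w + g w u) \<le> P u"
    "\<And>u w. (u, w) \<in> H \<Longrightarrow> (\<Sum>z\<in>V. g u z + g z u) = P u \<or> (\<Sum>z\<in>V. g w z + g z w) = P w"
    using insert.IH insert.prems by (fastforce split: prod.splits)
  let ?L = "\<lambda>u. \<Sum>z\<in>V. g u z + g z u"
  define x where "x = min (P a - ?L a) (P b - ?L b)"
  have x: "x \<ge> 0" using g(3) V by (simp add: x_def)
  define g' where "g' = (\<lambda>u w. g u w + (if u = a \<and> w = b then x else 0))"
  let ?L' = "\<lambda>u. \<Sum>z\<in>V. g' u z + g' z u"
  have L': "?L' u = ?L u + (if u = a \<or> u = b then x else 0)" for u
  proof -
    have "?L' u = ?L u + (\<Sum>z\<in>V. (if z = b then (if u = a then x else 0) else 0)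
        + (if z = a then (if u = b then x else 0) else 0))"
      unfolding g'_def sum.distrib[symmetric] by (intro sum.cong) auto
    also have "\<dots> = ?L u + (if u = a \<or> u = b then x else 0)"
      using V ne assms(1) by (simp add: sum.distrib)
    finally show ?thesis .
  qed
  have le: "?L' u \<le> P u" if "u \<in> V" for u
    using g(3)[OF that] unfolding L' by (auto simp: x_def min_def)
  have sat: "?L' u = P u" if "u \<in> V" "?L u = P u" for u
    using le[OF that(1)] that(2) x unfolding L' by (auto split: if_splits)
  have "?L' a = P a \<or> ?L' b = P b" unfolding L' by (auto simp: x_def min_def)
  moreover have "?L' u = P u \<or> ?L' w = P w" if "(u, w) \<in> H" for u w
    using g(4)[OF that] sat that insert.prems by blast
  moreover have "(u, w) \<notin> insert ab H \<Longrightarrow> g' u w = 0" for u w using g(2) by (auto simp: g'_def ab)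
  moreover have "g' u w \<ge> 0" for u w using g(1) x by (auto simp: g'_def)
  ultimately show ?case using le by (intro exI[of _ g']) (auto simp: ab)
qed

text \<open>Adding the greedy matching to its transpose turns the load counted in both orientations
  into a row sum.\<close>

lemma symmetric_fractional_matching:
  fixes P :: "'a \<Rightarrow> real"
  assumes "finite V" "G \<subseteq> V \<times> V" "\<And>u. (u, u) \<notin> G" "\<And>u. u \<in> V \<Longrightarrow> P u \<ge> 0" "sym G"
  shows "\<exists>f. (\<forall>u w. f u w \<ge> 0 \<and> f u w = f w u) \<and> (\<forall>u w. (u, w) \<notin> G \<longrightarrow> f u w = 0) \<and>
    (\<forall>u\<in>V. (\<Sum>w\<in>V. f u w) \<le> P u) \<and>
    (\<forall>(u, w)\<in>G. (\<Sum>z\<in>V. f u z) = P u \<or> (\<Sum>z\<in>V. f w z) = P w)"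
proof -
  have "finite G" using assms(1,2) by (meson finite_SigmaI finite_subset)
  note matching = maximal_fractional_matching[where P = P, OF assms(1) this assms(2,3)]
  obtain g where
    g: "\<forall>u w. g u w \<ge> 0" "\<forall>u w. (u, w) \<notin> G \<longrightarrow> g u w = 0"
    "\<forall>u\<in>V. (\<Sum>w\<in>V. g u w + g w u) \<le> P u"
    "\<forall>(u, w)\<in>G. (\<Sum>z\<in>V. g u z + g z u) = P u \<or> (\<Sum>z\<in>V. g w z + g z w) = P w"
    using assms(4) by (elim exE[OF matching] conjE)
  have sym: "(w, u) \<in> G" if "(u, w) \<in> G" for u w using \<open>sym G\<close> that by (rule symD)
  show ?thesis
  proof (intro exI[of _ "\<lambda>u w. g u w + g w u"] conjI allI impI g(3,4))
    fix u w assume "(u, w) \<notin> G"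
    then show "g u w + g w u = 0" using g(2) sym[of w u] by auto
  qed (use g(1) in auto)
qed

subsection \<open>Metrics of negative type\<close>

lemma sqdist_conv_sqnorm: "sqdist n x y = sqnorm n (\<lambda>k. y k - x k)"
  by (simp add: sqdist_def sqnorm_def power2_commute)

lemma sqdist_commute: "sqdist n x y = sqdist n y x"
  by (simp add: sqdist_def power2_commute)

lemma sqdist_self [simp]: "sqdist n x x = 0"
  by (simp add: sqdist_def)

text \<open>Since the squared distances themselves obey the triangle inequality, \<open>k\<close>
  steps of squared length \<open>\<Delta>\<close> stay within squared distance
  \<open>k * \<Delta>\<close>, rather than \<open>k^2 * \<Delta>\<close>.\<close>

locale l2_squared_metric =
  fixes V :: "'a set" and P :: "'a \<Rightarrow> real" and N :: nat and u :: "'a \<Rightarrow> nat \<Rightarrow> real"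
  assumes finV: "finite V" and P_nonneg: "\<And>i. i \<in> V \<Longrightarrow> 0 \<le> P i" and P_sum: "(\<Sum>i\<in>V. P i) = 1"
    and tri: "\<And>i j k. \<lbrakk>i \<in> V; j \<in> V; k \<in> V\<rbrakk> \<Longrightarrow>
      sqdist N (u i) (u k) \<le> sqdist N (u i) (u j) + sqdist N (u j) (u k)"
begin

text \<open>For \<open>i \<in> V\<close> and \<open>\<rho> \<ge> 0\<close> the maximum is over a
  nonempty set, which contains \<open>i\<close> itself.\<close>

definition far :: "real \<Rightarrow> 'a \<Rightarrow> (nat \<Rightarrow> real) \<Rightarrow> real" where
  "far \<rho> i e = Max ((\<lambda>j. dotp N e (\<lambda>k. u j k - u i k)) ` {j \<in> V. sqdist N (u i) (u j) \<le> \<rho>})"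

lemma far_ge:
  assumes "j \<in> V" "sqdist N (u i) (u j) \<le> \<rho>"
  shows "dotp N e (u j) - dotp N e (u i) \<le> far \<rho> i e"
  unfolding far_def dotp_diff[symmetric] using assms finV by (intro Max_ge) auto

lemma far_attained:
  assumes "i \<in> V" "\<rho> \<ge> 0"
  obtains j where "j \<in> V" "sqdist N (u i) (u j) \<le> \<rho>" "far \<rho> i e = dotp N e (u j) - dotp N e (u i)"
proof -
  have "i \<in> {j \<in> V. sqdist N (u i) (u j) \<le> \<rho>}" using assms by simp
  then have "far \<rho> i e \<in> (\<lambda>j. dotp N e (\<lambda>k. u j k - u i k)) ` {j \<in> V. sqdist N (u i) (u j) \<le> \<rho>}"
    unfolding far_def using finV by (intro Max_in) auto
  then show ?thesis using that by (auto simp: dotp_diff)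
qed

lemma far_variance:
  assumes "i \<in> V" "\<rho> \<ge> 0"
  shows "cube_avg N (\<lambda>e. (far \<rho> i e - cube_avg N (far \<rho> i))\<^sup>2) \<le> 2 * \<rho>"
proof -
  let ?m = "cube_avg N (far \<rho> i)"
  have "i \<in> {j \<in> V. sqdist N (u i) (u j) \<le> \<rho>}" using assms by simp
  then have "cube_avg N (\<lambda>e. (far \<rho> i e)\<^sup>2) - ?m\<^sup>2 \<le> 2 * \<rho>"
    unfolding far_def using finV
    by (intro cube_variance_Max_le) (auto simp: sqdist_conv_sqnorm)
  moreover have "(\<lambda>e. (far \<rho> i e - ?m)\<^sup>2) = (\<lambda>e. (far \<rho> i e)\<^sup>2 - (2 * ?m) * far \<rho> i e + ?m\<^sup>2)"
    by (auto simp: power2_eq_square algebra_simps)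
  ultimately show ?thesis
    by (simp add: cube_avg_add cube_avg_diff cube_avg_cmult power2_eq_square)
qed

lemma far_avg_le:
  assumes "i \<in> V" "\<rho> \<ge> 0" "t > 0"
  shows "cube_avg N (far \<rho> i) \<le> ln (card V) / t + t * \<rho> / 2"
proof -
  let ?I = "{j \<in> V. sqdist N (u i) (u j) \<le> \<rho>}"
  have i: "i \<in> ?I" using assms by simp
  have "cube_avg N (far \<rho> i) \<le> ln (card ?I) / t + t * \<rho> / 2"
    unfolding far_def using finV i assms(3)
    by (intro cube_avg_Max_le) (auto simp: sqdist_conv_sqnorm)
  moreover have "card ?I \<le> card V" "card ?I > 0"
    using finV i by (auto intro: card_mono simp: card_gt_0_iff)
  then have "ln (card ?I) / t \<le> ln (card V) / t"
    using assms(3) by (intro divide_right_mono) auto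
  ultimately show ?thesis by linarith
qed

text \<open>Following a matched pair gains \<open>\<tau>\<close> in direction \<open>e\<close>. The bias \<open>s i\<close> between being
  the head and being the tail of a pair has mean zero because reversing \<open>e\<close> reverses the
  matching, so it costs only the standard deviation of \<open>far\<close>.\<close>
lemma far_step:
  fixes f :: "(nat \<Rightarrow> real) \<Rightarrow> 'a \<Rightarrow> 'a \<Rightarrow> real"
  assumes f_nonneg: "\<And>e i j. 0 \<le> f e i j"
    and f_supp: "\<And>e i j. \<lbrakk>i \<in> V; j \<in> V; f e i j \<noteq> 0\<rbrakk> \<Longrightarrow>
      sqdist N (u i) (u j) \<le> \<Delta> \<and> \<tau> \<le> dotp N e (u j) - dotp N e (u i)"
    and f_load: "\<And>e i. i \<in> V \<Longrightarrow> (\<Sum>j\<in>V. f e i j + f e j i) \<le> P i"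
    and f_rev: "\<And>e i j. f (\<lambda>k. - e k) i j = f e j i"
    and f_mass: "2 * \<eta> \<le> \<tau> * cube_avg N (\<lambda>e. \<Sum>i\<in>V. \<Sum>j\<in>V. f e i j)"
    and pos: "\<eta> > 0" "\<Delta> \<ge> 0" "\<rho> \<ge> 0" "2 * \<rho> \<le> \<eta>\<^sup>2"
  shows "(\<Sum>i\<in>V. P i * cube_avg N (far \<rho> i)) + \<eta> \<le> (\<Sum>i\<in>V. P i * cube_avg N (far (\<rho> + \<Delta>) i))"
proof -
  \<comment> \<open>\<open>l e i\<close> and \<open>r e i\<close> are the masses of the pairs
    leaving and entering \<open>i\<close>. The load bound gives
    \<open>\<bar>s e i\<bar> \<le> P i\<close>.\<close>
  define l where "l e i = (\<Sum>j\<in>V. f e i j)" for e i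
  define r where "r e i = (\<Sum>j\<in>V. f e j i)" for e i
  define s where "s e i = r e i - l e i" for e i
  have lr: "l e i \<ge> 0" "r e i \<ge> 0" for e i
    using f_nonneg by (auto simp: l_def r_def intro: sum_nonneg)
  have lrP: "l e i + r e i \<le> P i" if "i \<in> V" for e i
    using f_load[OF that, of e] by (simp add: l_def r_def sum.distrib)
  let ?Y = "far \<rho>" and ?Z = "far (\<rho> + \<Delta>)"
  have mono: "?Y i e \<le> ?Z i e" if i: "i \<in> V" for i e
  proof -
    obtain j where "j \<in> V" "sqdist N (u i) (u j) \<le> \<rho>" "?Y i e = dotp N e (u j) - dotp N e (u i)"
      using far_attained[OF i pos(3), where e = e] by metis
    then show ?thesis using far_ge[of j i "\<rho> + \<Delta>" e] pos by auto
  qed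
  have step: "?Y j e + \<tau> \<le> ?Z i e" if ij: "i \<in> V" "j \<in> V" "f e i j \<noteq> 0" for i j e
  proof -
    obtain k where k: "k \<in> V" "sqdist N (u j) (u k) \<le> \<rho>" "?Y j e = dotp N e (u k) - dotp N e (u j)"
      using far_attained[OF ij(2) pos(3), where e = e] by metis
    have "sqdist N (u i) (u k) \<le> \<rho> + \<Delta>"
      using tri[OF ij(1,2) k(1)] f_supp[OF ij] k(2) by linarith
    then show ?thesis using far_ge[OF k(1), of i "\<rho> + \<Delta>" e] f_supp[OF ij] k(3) by linarith
  qed
  have pt: "(\<Sum>i\<in>V. P i * ?Y i e) + \<tau> * (\<Sum>i\<in>V. l e i) + (\<Sum>i\<in>V. s e i * ?Y i e) \<le> (\<Sum>i\<in>V. P i * ?Z i e)" for e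
  proof -
    \<comment> \<open>The part of \<open>P i\<close> matched as a tail moves on to its partners and
      gains \<open>\<tau>\<close>; the rest keeps its value of \<open>far \<rho>\<close>.\<close>
    have one: "(P i - l e i) * ?Y i e + (\<Sum>j\<in>V. f e i j * (?Y j e + \<tau>)) \<le> P i * ?Z i e" if i: "i \<in> V" for i
    proof -
      have "f e i j * (?Y j e + \<tau>) \<le> f e i j * ?Z i e" if "j \<in> V" for j
        using step[OF i that, of e] f_nonneg[of e i j] by (cases "f e i j = 0") (auto intro: mult_left_mono)
      then have "(\<Sum>j\<in>V. f e i j * (?Y j e + \<tau>)) \<le> l e i * ?Z i e"
        unfolding l_def sum_distrib_right by (rule sum_mono)
      moreover have "(P i - l e i) * ?Y i e \<le> (P i - l e i) * ?Z i e"
        using mono[OF i] lrP[OF i, of e] lr[of e i] by (intro mult_left_mono) auto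
      ultimately show ?thesis by (simp add: algebra_simps)
    qed
    have "(\<Sum>i\<in>V. \<Sum>j\<in>V. f e i j * ?Y j e) = (\<Sum>j\<in>V. r e j * ?Y j e)"
      unfolding r_def sum_distrib_right by (rule sum.swap)
    moreover have "(\<Sum>i\<in>V. \<Sum>j\<in>V. f e i j * \<tau>) = \<tau> * (\<Sum>i\<in>V. l e i)"
      by (simp add: l_def sum_distrib_left mult.commute)
    moreover have "(\<Sum>i\<in>V. (P i - l e i) * ?Y i e + (\<Sum>j\<in>V. f e i j * (?Y j e + \<tau>))) \<le> (\<Sum>i\<in>V. P i * ?Z i e)"
      by (rule sum_mono[OF one])
    ultimately show ?thesis
      by (simp add: s_def algebra_simps sum.distrib sum_subtractf)
  qed
  have bias: "- (P i * \<eta>) \<le> cube_avg N (\<lambda>e. s e i * ?Y i e)" if i: "i \<in> V" for i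
  proof -
    define m where "m = cube_avg N (?Y i)"
    \<comment> \<open>Reversing \<open>e\<close> exchanges \<open>l\<close> and \<open>r\<close>, so
      \<open>s\<close> has mean zero and \<open>far\<close> may be centred.\<close>
    have "cube_avg N (\<lambda>e. l e i) = cube_avg N (\<lambda>e. l (\<lambda>k. - e k) i)"
      by (rule cube_avg_reflect[symmetric])
    then have "cube_avg N (\<lambda>e. s e i) = 0"
      by (simp add: s_def cube_avg_diff l_def r_def f_rev)
    then have eq: "cube_avg N (\<lambda>e. s e i * ?Y i e) = cube_avg N (\<lambda>e. s e i * (?Y i e - m))"
      by (simp add: right_diff_distrib cube_avg_diff mult.commute[of _ m] cube_avg_cmult)
    have "- (P i * (\<eta> / 2)) - (P i / (2 * \<eta>)) * (?Y i e - m)\<^sup>2 \<le> s e i * (?Y i e - m)" for e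
    proof -
      let ?y = "?Y i e - m"
      \<comment> \<open>AM-GM at scale \<open>\<eta>\<close>: as the variance is at most
        \<open>2 * \<rho> \<le> \<eta>\<^sup>2\<close>, each of the two resulting terms averages to
        at most \<open>P i * \<eta> / 2\<close>.\<close>
      have "0 \<le> (\<bar>?y\<bar> - \<eta>)\<^sup>2" by simp
      then have "2 * \<eta> * \<bar>?y\<bar> \<le> \<eta>\<^sup>2 + ?y\<^sup>2" by (simp add: power2_eq_square algebra_simps)
      then have y: "\<bar>?y\<bar> \<le> \<eta> / 2 + ?y\<^sup>2 / (2 * \<eta>)"
        using pos(1) by (simp add: field_simps power2_eq_square)
      have "\<bar>s e i * ?y\<bar> \<le> P i * \<bar>?y\<bar>"
        unfolding abs_mult using lr[of e i] lrP[OF i, of e] by (intro mult_right_mono) (auto simp: s_def)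
      also have "\<dots> \<le> P i * (\<eta> / 2 + ?y\<^sup>2 / (2 * \<eta>))"
        using y P_nonneg[OF i] by (rule mult_left_mono)
      finally show ?thesis by (simp add: algebra_simps)
    qed
    then have "- (P i * (\<eta> / 2)) - (P i / (2 * \<eta>)) * cube_avg N (\<lambda>e. (?Y i e - m)\<^sup>2)
        \<le> cube_avg N (\<lambda>e. s e i * (?Y i e - m))"
      using cube_avg_mono[of "\<lambda>e. - (P i * (\<eta> / 2)) - (P i / (2 * \<eta>)) * (?Y i e - m)\<^sup>2" _ N]
      by (simp only: cube_avg_diff cube_avg_cmult cube_avg_const)
    moreover have "(P i / (2 * \<eta>)) * cube_avg N (\<lambda>e. (?Y i e - m)\<^sup>2) \<le> (P i / (2 * \<eta>)) * \<eta>\<^sup>2"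
      using far_variance[OF i pos(3)] pos P_nonneg[OF i] by (intro mult_left_mono) (auto simp: m_def)
    moreover have "(P i / (2 * \<eta>)) * \<eta>\<^sup>2 = P i * (\<eta> / 2)"
      using pos(1) by (simp add: power2_eq_square)
    ultimately show ?thesis unfolding eq by (simp add: algebra_simps)
  qed
  have "(\<Sum>i\<in>V. P i * cube_avg N (?Y i)) + \<tau> * cube_avg N (\<lambda>e. \<Sum>i\<in>V. l e i)
      + (\<Sum>i\<in>V. cube_avg N (\<lambda>e. s e i * ?Y i e)) \<le> (\<Sum>i\<in>V. P i * cube_avg N (?Z i))"
    using cube_avg_mono[OF pt, of N] by (simp add: cube_avg_add cube_avg_sum cube_avg_cmult)
  moreover have "(\<Sum>i\<in>V. - (P i * \<eta>)) \<le> (\<Sum>i\<in>V. cube_avg N (\<lambda>e. s e i * ?Y i e))"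
    by (rule sum_mono[OF bias])
  moreover have "(\<Sum>i\<in>V. - (P i * \<eta>)) = - \<eta>"
    using P_sum by (simp add: sum_negf sum_distrib_right[symmetric])
  ultimately show ?thesis using f_mass unfolding l_def by linarith
qed

text \<open>Every step raises the weighted mean of \<open>far\<close> by \<open>\<eta>\<close>, so
  it reaches \<open>K * \<eta>\<close>. The radius is still at most
  \<open>\<eta>\<^sup>2 / 2\<close>, where the sub-Gaussian bound allows only
  \<open>\<eta> * sqrt (ln n)\<close> for \<open>n\<close> points.\<close>

lemma matching_chain_bound:
  fixes f :: "(nat \<Rightarrow> real) \<Rightarrow> 'a \<Rightarrow> 'a \<Rightarrow> real" and K :: nat
  assumes f: "\<And>e i j. 0 \<le> f e i j"
    "\<And>e i j. \<lbrakk>i \<in> V; j \<in> V; f e i j \<noteq> 0\<rbrakk> \<Longrightarrow>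
      sqdist N (u i) (u j) \<le> \<Delta> \<and> \<tau> \<le> dotp N e (u j) - dotp N e (u i)"
    "\<And>e i. i \<in> V \<Longrightarrow> (\<Sum>j\<in>V. f e i j + f e j i) \<le> P i"
    "\<And>e i j. f (\<lambda>k. - e k) i j = f e j i"
    "2 * \<eta> \<le> \<tau> * cube_avg N (\<lambda>e. \<Sum>i\<in>V. \<Sum>j\<in>V. f e i j)"
    and pos: "\<eta> > 0" "\<Delta> \<ge> 0" "2 * (real K * \<Delta>) \<le> \<eta>\<^sup>2" and card: "card V \<ge> 2"
  shows "K \<le> sqrt (ln (card V))"
proof -
  let ?\<Phi> = "\<lambda>k. \<Sum>i\<in>V. P i * cube_avg N (far (real k * \<Delta>) i)"
  have low: "real k * \<eta> \<le> ?\<Phi> k" if "k \<le> K" for k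
    using that
  proof (induction k)
    case 0
    have "0 \<le> far 0 i e" if "i \<in> V" for i e using far_ge[OF that, of i 0 e] by simp
    then have "0 \<le> cube_avg N (far 0 i)" if "i \<in> V" for i
      using cube_avg_mono[of "\<lambda>_. 0" "far 0 i" N] that by simp
    then show ?case using P_nonneg by (auto intro!: sum_nonneg)
  next
    case (Suc k)
    have "2 * (real k * \<Delta>) \<le> 2 * (real K * \<Delta>)"
      using Suc.prems pos(2) by (intro mult_left_mono mult_right_mono) auto
    then have "?\<Phi> k + \<eta> \<le> (\<Sum>i\<in>V. P i * cube_avg N (far (real k * \<Delta> + \<Delta>) i))"
      using pos by (intro far_step[OF f]) auto
    moreover have "real k * \<Delta> + \<Delta> = real (Suc k) * \<Delta>" by (simp add: algebra_simps)
    ultimately show ?case using Suc by (simp add: algebra_simps)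
  qed
  define L where "L = sqrt (ln (card V))"
  have L: "L > 0" "L * L = ln (card V)" using card by (auto simp: L_def)
  \<comment> \<open>This choice makes both terms of the maximal bound equal to
    \<open>L * \<eta> / 2\<close>.\<close>
  define t where "t = 2 * L / \<eta>"
  have t: "t > 0" using L pos by (simp add: t_def)
  have "?\<Phi> K \<le> (\<Sum>i\<in>V. P i * (ln (card V) / t + t * (real K * \<Delta>) / 2))"
    using t pos P_nonneg by (intro sum_mono mult_left_mono far_avg_le) auto
  also have "\<dots> = ln (card V) / t + t * (real K * \<Delta>) / 2"
    using P_sum by (simp add: sum_distrib_right[symmetric])
  also have "\<dots> \<le> ln (card V) / t + t * (\<eta>\<^sup>2 / 2) / 2"
    using t pos by (intro add_left_mono divide_right_mono mult_left_mono) auto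
  also have "\<dots> = L * \<eta>"
    using L(1) pos(1) unfolding L(2)[symmetric] t_def by (simp add: field_simps power2_eq_square)
  finally have "real K * \<eta> \<le> L * \<eta>" using low[of K] by simp
  then show ?thesis using pos(1) by (simp add: L_def)
qed

text \<open>Since \<open>G\<close> below is unchanged when \<open>e\<close> is reversed, choosing the matching as a function
  of \<open>G\<close> alone makes it antisymmetric in \<open>e\<close>.\<close>
lemma separated_sets:
  fixes K :: nat
  assumes center: "\<And>k. k < N \<Longrightarrow> (\<Sum>i\<in>V. P i * u i k) = 0"
    and second: "(\<Sum>i\<in>V. P i * sqnorm N (u i)) = 1"
    and first: "1 / 4 \<le> (\<Sum>i\<in>V. P i * sqrt (sqnorm N (u i)))"
    and card: "card V \<ge> 2" and K: "sqrt (ln (card V)) < K"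
  shows "\<exists>A B. A \<subseteq> V \<and> B \<subseteq> V \<and> 1 / 1024 \<le> sum P A \<and> 1 / 1024 \<le> sum P B \<and>
    (\<forall>i\<in>A. \<forall>j\<in>B. (1 / 65536)\<^sup>2 / (2 * K) \<le> sqdist N (u i) (u j))"
proof (rule ccontr)
  assume contra: "\<not> ?thesis"
  \<comment> \<open>Each matched pair gains \<open>2 * \<sigma> = 1 / 32\<close> and the mean
    matched mass will be at least 1/1024. This affords \<open>\<eta> = 1 / 65536\<close>, and
    \<open>\<Delta>\<close> is then set so that
    \<open>2 * K * \<Delta> = \<eta>\<^sup>2\<close>.\<close>
  define \<sigma> :: real where "\<sigma> = 1 / 64"
  define \<Delta> :: real where "\<Delta> = (1 / 65536)\<^sup>2 / (2 * K)"
  have sig: "\<sigma> > 0" by (simp add: \<sigma>_def)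
  define X where "X e i = dotp N e (u i)" for e i
  define G where "G e = {(i, j) \<in> V \<times> V. sqdist N (u i) (u j) \<le> \<Delta> \<and>
     (X e i \<le> - \<sigma> \<and> \<sigma> \<le> X e j \<or> \<sigma> \<le> X e i \<and> X e j \<le> - \<sigma>)}" for e
  define good where "good H f \<longleftrightarrow> (\<forall>i j. f i j \<ge> 0 \<and> f i j = f j i) \<and> (\<forall>i j. (i, j) \<notin> H \<longrightarrow> f i j = 0) \<and>
    (\<forall>i\<in>V. (\<Sum>j\<in>V. f i j) \<le> P i) \<and>
    (\<forall>(i, j)\<in>H. (\<Sum>z\<in>V. f i z) = P i \<or> (\<Sum>z\<in>V. f j z) = P j)" for H :: "('a \<times> 'a) set" and f :: "'a \<Rightarrow> 'a \<Rightarrow> real"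
  define M where "M e = (SOME f. good (G e) f)" for e
  have "\<exists>f. good (G e) f" for e
    unfolding good_def using finV P_nonneg sig
    by (intro symmetric_fractional_matching) (auto simp: G_def sym_def sqdist_commute)
  then have M: "good (G e) (M e)" for e unfolding M_def by (rule someI_ex)
  have M1: "M e i j \<ge> 0" "M e i j = M e j i" "M e i j \<noteq> 0 \<Longrightarrow> (i, j) \<in> G e" for e i j
    using M[of e] unfolding good_def by blast+
  have M2: "(\<Sum>j\<in>V. M e i j) \<le> P i" if "i \<in> V" for e i
    using M[of e] that unfolding good_def by blast
  have M3: "(\<Sum>z\<in>V. M e i z) = P i \<or> (\<Sum>z\<in>V. M e j z) = P j" if "(i, j) \<in> G e" for e i j
    using M[of e] that unfolding good_def by blast
  have X_rev: "X (\<lambda>k. - e k) i = - X e i" for e i by (simp add: X_def dotp_uminus)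
  have "G (\<lambda>k. - e k) = G e" for e unfolding G_def X_rev by auto
  then have M_rev: "M (\<lambda>k. - e k) = M e" for e by (simp add: M_def)
  \<comment> \<open>Of each symmetric pair only the orientation from low to high projection is
    kept.\<close>
  define f where "f e i j = (if X e i \<le> - \<sigma> then M e i j else 0)" for e i j
  define mass where "mass e = (\<Sum>i\<in>V. \<Sum>j\<in>V. f e i j)" for e
  have f_nonneg: "f e i j \<ge> 0" for e i j using M1 by (simp add: f_def)
  have f_rev: "f (\<lambda>k. - e k) i j = f e j i" for e i j
    using M1(3)[of e i j] M1(2)[of e i j] sig unfolding f_def M_rev X_rev G_def
    by (cases "M e i j = 0") auto
  have f_supp: "sqdist N (u i) (u j) \<le> \<Delta> \<and> 2 * \<sigma> \<le> dotp N e (u j) - dotp N e (u i)"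
    if "f e i j \<noteq> 0" for e i j
    using M1(3)[of e i j] that sig unfolding f_def G_def X_def by (auto split: if_splits)
  have f_load: "(\<Sum>j\<in>V. f e i j + f e j i) \<le> P i" if "i \<in> V" for e i
  proof -
    have "f e i j + f e j i \<le> M e i j" for j
      using M1(1,3)[of e i j] M1(2)[of e i j] sig unfolding f_def G_def by (cases "M e i j = 0") auto
    then have "(\<Sum>j\<in>V. f e i j + f e j i) \<le> (\<Sum>j\<in>V. M e i j)" by (rule sum_mono)
    then show ?thesis using M2[OF that] by (rule order_trans)
  qed
  define A where "A e = {i \<in> V. X e i \<le> - \<sigma>}" for e
  define B where "B e = {i \<in> V. \<sigma> \<le> X e i}" for e
  \<comment> \<open>Unsaturated points on opposite sides are not joined in \<open>G e\<close>, hence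
    lie at squared distance at least \<open>\<Delta>\<close>. By \<open>contra\<close>, one of the
    two unsaturated sets weighs less than 1/1024.\<close>
  have large: "min (sum P (A e)) (sum P (B e)) - 1 / 1024 \<le> mass e" for e
  proof -
    let ?l = "\<lambda>i. \<Sum>j\<in>V. M e i j"
    define A' where "A' = {i \<in> A e. ?l i \<noteq> P i}"
    define B' where "B' = {i \<in> B e. ?l i \<noteq> P i}"
    have fin: "finite (A e)" "finite (B e)" using finV by (auto simp: A_def B_def)
    have split: "sum P C = sum P {i \<in> C. ?l i \<noteq> P i} + (\<Sum>i\<in>{i \<in> C. ?l i = P i}. ?l i)"
      if "finite C" for C
    proof -
      have "sum P C = sum P {i \<in> C. ?l i \<noteq> P i} + sum P {i \<in> C. ?l i = P i}"
        using that by (subst sum.union_disjoint[symmetric]) (auto intro!: sum.cong)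
      then show ?thesis by simp
    qed
    have part: "(\<Sum>i\<in>{i \<in> C. ?l i = P i}. ?l i) \<le> (\<Sum>i\<in>C. ?l i)" if "finite C" for C
      using that M1(1) by (intro sum_mono2) (auto intro: sum_nonneg)
    have "(\<Sum>i\<in>A e. ?l i) = (\<Sum>i\<in>A e. \<Sum>j\<in>V. f e i j)"
      by (intro sum.cong refl) (auto simp: A_def f_def)
    also have "\<dots> \<le> mass e"
      unfolding mass_def using finV f_nonneg by (intro sum_mono2) (auto simp: A_def intro: sum_nonneg)
    finally have lA: "sum P (A e) \<le> sum P A' + mass e"
      using split[OF fin(1)] part[OF fin(1)] unfolding A'_def by linarith
    have "(\<Sum>i\<in>B e. ?l i) = (\<Sum>i\<in>B e. \<Sum>j\<in>V. f e j i)"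
    proof (intro sum.cong refl)
      fix i j assume "i \<in> B e" "j \<in> V"
      then show "M e i j = f e j i"
        using M1(2,3)[of e i j] sig by (auto simp: B_def f_def G_def)
    qed
    also have "\<dots> \<le> (\<Sum>i\<in>V. \<Sum>j\<in>V. f e j i)"
      using finV f_nonneg by (intro sum_mono2) (auto simp: B_def intro: sum_nonneg)
    also have "\<dots> = mass e" unfolding mass_def by (rule sum.swap)
    finally have lB: "sum P (B e) \<le> sum P B' + mass e"
      using split[OF fin(2)] part[OF fin(2)] unfolding B'_def by linarith
    have "\<Delta> \<le> sqdist N (u i) (u j)" if ij: "i \<in> A'" "j \<in> B'" for i j
    proof (rule ccontr)
      assume "\<not> \<Delta> \<le> sqdist N (u i) (u j)"
      then have "(i, j) \<in> G e" using ij by (auto simp: G_def A'_def B'_def A_def B_def)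
      then show False using M3[of i j e] ij by (auto simp: A'_def B'_def)
    qed
    moreover have "A' \<subseteq> V" "B' \<subseteq> V" by (auto simp: A'_def B'_def A_def B_def)
    ultimately have "sum P A' < 1 / 1024 \<or> sum P B' < 1 / 1024"
      using contra unfolding \<Delta>_def[symmetric] by (meson not_le)
    then show ?thesis using lA lB by linarith
  qed
  define q where "q e = (\<Sum>i\<in>V. P i * \<bar>X e i\<bar>)" for e
  define s where "s e = (\<Sum>i\<in>V. P i * (X e i)\<^sup>2)" for e
  have pt: "(1 / 32) * q e - (1 / 1024) - (1 / 1024) * s e \<le> min (sum P (A e)) (sum P (B e))" for e
  proof -
    have zero: "(\<Sum>i\<in>V. P i * X e i) = 0"
    proof -
      have "(\<Sum>i\<in>V. P i * X e i) = (\<Sum>k<N. e k * (\<Sum>i\<in>V. P i * u i k))"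
        unfolding X_def dotp_def sum_distrib_left by (subst sum.swap) (simp add: mult_ac)
      then show ?thesis using center by simp
    qed
    \<comment> \<open>As the projections have mean zero, positive and negative parts each carry half
      of \<open>q e\<close>. The sign \<open>c\<close> selects the tail, and \<open>one\<close>
      trades the part beyond \<open>\<sigma>\<close> for its weight and a second moment.\<close>
    have est: "q e / 2 \<le> 1 / 64 + s e / 64 + 16 * sum P {i \<in> V. \<sigma> \<le> c * X e i}" if c: "c = 1 \<or> c = -1" for c
    proof -
      have one: "(\<bar>x\<bar> + x) / 2 \<le> 1 / 64 + x\<^sup>2 / 64 + 16 * (if \<sigma> \<le> x then 1 else 0)" for x :: real
      proof (cases "\<sigma> \<le> x")
        case True
        have "0 \<le> (x / 8 - 4)\<^sup>2" by simp
        then show ?thesis using True sig by (simp add: power2_eq_square field_simps)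
      next
        case False
        then have "(\<bar>x\<bar> + x) / 2 \<le> 1 / 64" by (auto simp: abs_if \<sigma>_def)
        moreover have "0 \<le> x\<^sup>2 / 64" by simp
        ultimately show ?thesis unfolding if_not_P[OF False] by linarith
      qed
      have "(\<Sum>i\<in>V. P i * ((\<bar>c * X e i\<bar> + c * X e i) / 2))
        \<le> (\<Sum>i\<in>V. P i * (1 / 64 + (c * X e i)\<^sup>2 / 64 + 16 * (if \<sigma> \<le> c * X e i then 1 else 0)))"
        using P_nonneg by (intro sum_mono mult_left_mono one)
      also have "\<dots> = 1 / 64 + s e / 64 + 16 * (\<Sum>i\<in>V. if \<sigma> \<le> c * X e i then P i else 0)"
      proof -
        have "(\<Sum>i\<in>V. P i * (1 / 64 + (c * X e i)\<^sup>2 / 64 + 16 * (if \<sigma> \<le> c * X e i then 1 else 0)))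
          = (\<Sum>i\<in>V. P i * (1 / 64) + P i * (X e i)\<^sup>2 * (1 / 64) + 16 * (if \<sigma> \<le> c * X e i then P i else 0))"
          using c by (intro sum.cong) (auto simp: algebra_simps)
        also have "\<dots> = 1 / 64 + s e / 64 + 16 * (\<Sum>i\<in>V. if \<sigma> \<le> c * X e i then P i else 0)"
          using P_sum unfolding sum.distrib sum_distrib_left[symmetric] sum_distrib_right[symmetric] s_def by simp
        finally show ?thesis .
      qed
      also have "(\<Sum>i\<in>V. if \<sigma> \<le> c * X e i then P i else 0) = sum P {i \<in> V. \<sigma> \<le> c * X e i}"
        using finV by (simp add: sum.inter_filter)
      also have "(\<Sum>i\<in>V. P i * ((\<bar>c * X e i\<bar> + c * X e i) / 2)) = q e / 2"
      proof -
        have "(\<Sum>i\<in>V. P i * ((\<bar>c * X e i\<bar> + c * X e i) / 2))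
          = (\<Sum>i\<in>V. (1 / 2) * (P i * \<bar>X e i\<bar>) + (c / 2) * (P i * X e i))"
          using c by (intro sum.cong) (auto simp: algebra_simps)
        also have "\<dots> = (1 / 2) * q e + (c / 2) * 0"
          unfolding sum.distrib sum_distrib_left[symmetric] q_def zero ..
        finally show ?thesis by simp
      qed
      finally show ?thesis .
    qed
    have "{i \<in> V. \<sigma> \<le> 1 * X e i} = B e" "{i \<in> V. \<sigma> \<le> -1 * X e i} = A e"
      by (auto simp: A_def B_def)
    then show ?thesis using est[of 1] est[of "-1"] by auto
  qed
  have "(1 / 32) * q e - (1 / 512) - (1 / 1024) * s e \<le> mass e" for e
    using pt[of e] large[of e] by linarith
  then have avg: "(1 / 32) * cube_avg N q - (1 / 512) - (1 / 1024) * cube_avg N s \<le> cube_avg N mass"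
    using cube_avg_mono[of "\<lambda>e. (1 / 32) * q e - (1 / 512) - (1 / 1024) * s e" mass N]
    by (simp only: cube_avg_diff cube_avg_cmult cube_avg_const)
  have "cube_avg N s = 1"
    unfolding s_def X_def using second by (simp add: cube_avg_sum cube_avg_cmult cube_avg_dotp_sq)
  moreover have "1 / 8 \<le> cube_avg N q"
  proof -
    have "(\<Sum>i\<in>V. P i * (sqrt (sqnorm N (u i)) / 2)) \<le> cube_avg N q"
      unfolding q_def X_def cube_avg_sum cube_avg_cmult
      using P_nonneg by (intro sum_mono mult_left_mono cube_avg_abs_dotp)
    then show ?thesis using first by (simp add: sum_divide_distrib[symmetric])
  qed
  \<comment> \<open>The arithmetic is
    \<open>1 / 256 - 1 / 512 - 1 / 1024 = 1 / 1024\<close>.\<close>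
  ultimately have mass: "1 / 1024 \<le> cube_avg N mass" using avg by simp
  have Kpos: "real K > 0" using K card by (smt (verit) ln_ge_zero of_nat_1 of_nat_le_iff one_le_numeral order_trans real_sqrt_ge_zero)
  have "K \<le> sqrt (ln (card V))"
  proof (rule matching_chain_bound[where f = f and \<Delta> = \<Delta> and \<tau> = "2 * \<sigma>" and \<eta> = "1 / 65536"])
    show "2 * (1 / 65536) \<le> 2 * \<sigma> * cube_avg N (\<lambda>e. \<Sum>i\<in>V. \<Sum>j\<in>V. f e i j)"
      using mass unfolding mass_def[abs_def] \<sigma>_def by simp
    show "2 * (real K * \<Delta>) \<le> (1 / 65536)\<^sup>2" "0 \<le> \<Delta>"
      using Kpos by (auto simp: \<Delta>_def)
  qed (use f_nonneg f_supp f_load f_rev card in auto)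
  then show False using K by simp
qed

section \<open>Spread of a centred embedding\<close>

lemma sqrt_sqnorm_diff:
  "sqrt (sqnorm N y) \<le> sqrt (sqdist N x y) + sqrt (sqnorm N x)"
  using L2_set_triangle_ineq[of "\<lambda>k. y k - x k" x "{..<N}"]
  by (simp add: L2_set_def sqdist_conv_sqnorm sqnorm_def)

text \<open>By Markov's inequality half the weight lies in the ball of radius 1/2. The unit second
  moment must then come from points outside, whose squared excess over the radius bounds their
  squared distance to the ball from below.\<close>

lemma concentrated_spread:
  assumes second: "(\<Sum>i\<in>V. P i * sqnorm N (u i)) = 1"
    and first: "(\<Sum>i\<in>V. P i * sqrt (sqnorm N (u i))) \<le> 1 / 4"
  shows "\<exists>A \<delta>. A \<subseteq> V \<and> (\<forall>j\<in>V. 0 \<le> \<delta> j) \<and> (\<forall>i\<in>A. \<forall>j\<in>V. \<delta> j \<le> sqdist N (u i) (u j)) \<and>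
    1 / 8 \<le> sum P A * (\<Sum>j\<in>V. P j * \<delta> j)"
proof -
  let ?n = "\<lambda>i. sqrt (sqnorm N (u i))"
  define A where "A = {i \<in> V. ?n i \<le> 1 / 2}"
  define \<delta> where "\<delta> j = (max 0 (?n j - 1 / 2))\<^sup>2" for j
  have n0: "0 \<le> ?n i" for i by (simp add: sqnorm_nonneg)
  have "1 / 2 \<le> sum P A"
  proof -
    have "(\<Sum>i\<in>V. P i - 2 * (P i * ?n i)) \<le> (\<Sum>i\<in>V. if ?n i \<le> 1 / 2 then P i else 0)"
    proof (intro sum_mono)
      fix i assume "i \<in> V"
      have "P i * 1 \<le> P i * (2 * ?n i)" if "\<not> ?n i \<le> 1 / 2"
        using that P_nonneg[OF \<open>i \<in> V\<close>] by (intro mult_left_mono) auto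
      then show "P i - 2 * (P i * ?n i) \<le> (if ?n i \<le> 1 / 2 then P i else 0)"
        using P_nonneg[OF \<open>i \<in> V\<close>] n0[of i] by auto
    qed
    also have "\<dots> = sum P A" unfolding A_def using finV by (simp add: sum.inter_filter)
    finally show ?thesis using first P_sum by (simp add: sum_subtractf sum_distrib_left[symmetric])
  qed
  moreover have "1 / 4 \<le> (\<Sum>j\<in>V. P j * \<delta> j)"
  proof -
    \<comment> \<open>For \<open>x > 1 / 2\<close> the difference of the two sides is half of the
      square of \<open>x - 1\<close>.\<close>
    have "x\<^sup>2 / 2 - 1 / 4 \<le> (max 0 (x - 1 / 2))\<^sup>2" if "0 \<le> x" for x :: real
    proof (cases "x \<le> 1 / 2")
      case True
      then have "x\<^sup>2 \<le> (1 / 2)\<^sup>2" using that by (intro power_mono) auto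
      then show ?thesis using True by (simp add: power2_eq_square max_absorb1)
    next
      case False
      have "0 \<le> (x - 1)\<^sup>2" by simp
      then show ?thesis using False by (simp add: power2_eq_square max_def algebra_simps)
    qed
    from this[OF n0] have "sqnorm N (u j) / 2 - 1 / 4 \<le> \<delta> j" for j
      unfolding \<delta>_def by (simp add: sqnorm_nonneg)
    then have "(\<Sum>j\<in>V. P j * (sqnorm N (u j) / 2 - 1 / 4)) \<le> (\<Sum>j\<in>V. P j * \<delta> j)"
      using P_nonneg by (intro sum_mono mult_left_mono) auto
    moreover have "(\<Sum>j\<in>V. P j * (sqnorm N (u j) / 2 - 1 / 4)) = 1 / 4"
      using second P_sum by (simp add: right_diff_distrib sum_subtractf sum_divide_distrib[symmetric])
    ultimately show ?thesis by simp
  qed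
  ultimately have "1 / 2 * (1 / 4) \<le> sum P A * (\<Sum>j\<in>V. P j * \<delta> j)"
    by (intro mult_mono) auto
  moreover have "\<delta> j \<le> sqdist N (u i) (u j)" if "i \<in> A" for i j
  proof -
    have "max 0 (?n j - 1 / 2) \<le> sqrt (sqdist N (u i) (u j))"
      using sqrt_sqnorm_diff[of "u j" "u i"] that by (auto simp: A_def sqdist_def intro: sum_nonneg)
    then have "(max 0 (?n j - 1 / 2))\<^sup>2 \<le> (sqrt (sqdist N (u i) (u j)))\<^sup>2"
      by (intro power_mono) auto
    then show ?thesis by (simp add: \<delta>_def sqdist_def sum_nonneg)
  qed
  moreover have "A \<subseteq> V" by (auto simp: A_def)
  ultimately show ?thesis by (intro exI[of _ A] exI[of _ \<delta>]) (auto simp: \<delta>_def)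
qed

text \<open>Either the first moment is small and the ball argument gives a constant, or separated
  sets \<open>A\<close> and \<open>B\<close> exist and \<open>\<delta>\<close> is
  \<open>\<Delta>\<close> on \<open>B\<close> and 0 elsewhere. Only the second case loses the factor
  \<open>K\<close>, of order \<open>sqrt (ln n)\<close> for \<open>n\<close> points.\<close>

lemma spread:
  assumes center: "\<And>k. k < N \<Longrightarrow> (\<Sum>i\<in>V. P i * u i k) = 0"
    and second: "(\<Sum>i\<in>V. P i * sqnorm N (u i)) = 1" and card: "card V \<ge> 2"
  shows "\<exists>A \<delta>. A \<subseteq> V \<and> (\<forall>j\<in>V. 0 \<le> \<delta> j) \<and> (\<forall>i\<in>A. \<forall>j\<in>V. \<delta> j \<le> sqdist N (u i) (u j)) \<and>
    1 / 2 ^ 60 \<le> sqrt (ln (card V)) * (sum P A * (\<Sum>j\<in>V. P j * \<delta> j))"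
proof -
  let ?L = "sqrt (ln (card V))"
  \<comment> \<open>A lower bound of 1/2 on \<open>?L\<close> makes rounding up harmless:
    \<open>K \<le> ?L + 1 \<le> 3 * ?L\<close>.\<close>
  have "ln 2 \<le> ln (card V)" using card by simp
  then have "1 / 4 \<le> ln (card V)" using ln2_ge_two_thirds by linarith
  then have "sqrt ((1 / 2)\<^sup>2) \<le> ?L" by (intro real_sqrt_le_mono) (simp add: power2_eq_square)
  then have L: "1 / 2 \<le> ?L" by simp
  show ?thesis
  proof (cases "(\<Sum>i\<in>V. P i * sqrt (sqnorm N (u i))) \<le> 1 / 4")
    case True
    then obtain A \<delta> where A: "A \<subseteq> V" "\<forall>j\<in>V. 0 \<le> \<delta> j" "\<forall>i\<in>A. \<forall>j\<in>V. \<delta> j \<le> sqdist N (u i) (u j)"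
      "1 / 8 \<le> sum P A * (\<Sum>j\<in>V. P j * \<delta> j)"
      using concentrated_spread[OF second] by auto
    have "1 / 2 * (1 / 8) \<le> ?L * (sum P A * (\<Sum>j\<in>V. P j * \<delta> j))"
      using L A(4) by (intro mult_mono) linarith+
    then show ?thesis using A(1-3) by (intro exI[of _ A] exI[of _ \<delta>]) auto
  next
    case False
    define K where "K = nat \<lfloor>?L\<rfloor> + 1"
    have K: "?L < real K" "real K \<le> 3 * ?L" using L unfolding K_def by linarith+
    define \<Delta> :: real where "\<Delta> = (1 / 65536)\<^sup>2 / (2 * K)"
    have Kp: "real K > 0" using K L by linarith
    obtain A B where AB: "A \<subseteq> V" "B \<subseteq> V" "1 / 1024 \<le> sum P A" "1 / 1024 \<le> sum P B"
      "\<And>i j. i \<in> A \<Longrightarrow> j \<in> B \<Longrightarrow> \<Delta> \<le> sqdist N (u i) (u j)"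
      using separated_sets[OF center second _ card K(1)] False unfolding \<Delta>_def by auto
    define \<delta> where "\<delta> j = (if j \<in> B then \<Delta> else 0)" for j
    have D0: "\<Delta> \<ge> 0" by (simp add: \<Delta>_def)
    have "(\<Sum>j\<in>V. P j * \<delta> j) = \<Delta> * sum P B"
    proof -
      have "(\<Sum>j\<in>V. P j * \<delta> j) = (\<Sum>j\<in>V. if j \<in> B then \<Delta> * P j else 0)"
        by (intro sum.cong) (auto simp: \<delta>_def)
      also have "\<dots> = (\<Sum>j\<in>B. \<Delta> * P j)" using AB(2) finV by (simp add: sum.inter_restrict[symmetric] Int_absorb1)
      finally show ?thesis by (simp add: sum_distrib_left)
    qed
    then have sep: "1 / 1024 * (\<Delta> * (1 / 1024)) \<le> sum P A * (\<Sum>j\<in>V. P j * \<delta> j)"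
      using mult_mono[OF AB(3) mult_left_mono[OF AB(4) D0]] AB(3) D0 by simp
    have "(real K / 3) * (1 / 1024 * (\<Delta> * (1 / 1024))) \<le> ?L * (sum P A * (\<Sum>j\<in>V. P j * \<delta> j))"
      using K D0 order_trans[OF _ L, of 0] by (intro mult_mono[OF _ sep]) auto
    moreover have "(real K / 3) * (1 / 1024 * (\<Delta> * (1 / 1024))) = (1 / 65536)\<^sup>2 / (6 * 1024 * 1024)"
      using Kp by (simp add: \<Delta>_def)
    ultimately have "(1 / 65536)\<^sup>2 / (6 * 1024 * 1024) \<le> ?L * (sum P A * (\<Sum>j\<in>V. P j * \<delta> j))"
      by (simp only:)
    moreover have "1 / 2 ^ 60 \<le> (1 / 65536)\<^sup>2 / (6 * 1024 * 1024 :: real)"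
      by (simp add: power2_eq_square)
    ultimately have "1 / 2 ^ 60 \<le> ?L * (sum P A * (\<Sum>j\<in>V. P j * \<delta> j))"
      by linarith
    then show ?thesis using AB D0
      by (intro exI[of _ A] exI[of _ \<delta>]) (auto simp: \<delta>_def sqdist_def sum_nonneg)
  qed
qed

end

subsection \<open>Circulation duality\<close>

text \<open>One equation expresses additivity and homogeneity together; \<open>s = -1\<close> and
  \<open>y = x\<close> give the value 0 at the zero function.\<close>

definition linear_fun :: "(('a \<Rightarrow> real) \<Rightarrow> real) \<Rightarrow> bool" where
  "linear_fun f \<longleftrightarrow> (\<forall>x y s. f (\<lambda>j. x j + s * y j) = f x + s * f y)"

lemma linear_funD: "linear_fun f \<Longrightarrow> f (\<lambda>j. x j + s * y j) = f x + s * f y"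
  by (simp add: linear_fun_def)

lemma linear_fun_scale:
  assumes "linear_fun f" shows "f (\<lambda>j. s * y j) = s * f y"
  using linear_funD[OF assms, of y "s - 1" y] by (simp add: algebra_simps)

text \<open>Bartl's inductive proof of Farkas' lemma.\<close>
lemma farkas:
  fixes \<alpha> :: "'i \<Rightarrow> ('a \<Rightarrow> real) \<Rightarrow> real"
  assumes "finite I" "\<And>i. i \<in> I \<Longrightarrow> linear_fun (\<alpha> i)" "linear_fun \<gamma>"
    and "\<And>x. (\<And>i. i \<in> I \<Longrightarrow> \<alpha> i x \<ge> 0) \<Longrightarrow> \<gamma> x \<ge> 0"
  shows "\<exists>c. (\<forall>i\<in>I. c i \<ge> 0) \<and> (\<forall>x. \<gamma> x = (\<Sum>i\<in>I. c i * \<alpha> i x))"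
  using assms
proof (induction I arbitrary: \<alpha> \<gamma> rule: finite_induct)
  case empty
  have "\<gamma> x = 0" for x
    using empty.prems(3)[of x] empty.prems(3)[of "\<lambda>j. (-1) * x j"] linear_fun_scale[OF empty.prems(2), of "-1" x]
    by simp
  then show ?case by simp
next
  case (insert m I)
  show ?case
  proof (cases "\<forall>x. (\<forall>i\<in>I. \<alpha> i x \<ge> 0) \<longrightarrow> \<gamma> x \<ge> 0")
    case True
    then obtain c where "\<forall>i\<in>I. c i \<ge> 0" "\<forall>x. \<gamma> x = (\<Sum>i\<in>I. c i * \<alpha> i x)"
      using insert.IH[of \<alpha> \<gamma>] insert.prems by auto
    then show ?thesis using insert.hyps
      by (intro exI[of _ "c(m := 0)"]) (auto intro!: sum.cong)
  next
    case False
    then obtain x0 where x0: "\<forall>i\<in>I. \<alpha> i x0 \<ge> 0" "\<gamma> x0 < 0" by (auto simp: not_le)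
    have neg: "\<alpha> m x0 < 0" using insert.prems(3)[of x0] x0 by force
    \<comment> \<open>Only the constraint \<open>m\<close> fails at \<open>x0\<close>; rescaling
      makes its value -1.\<close>
    define y where "y = (\<lambda>j. (- 1 / \<alpha> m x0) * x0 j)"
    have sc: "f y = (- 1 / \<alpha> m x0) * f x0" if "linear_fun f" for f
      unfolding y_def by (rule linear_fun_scale[OF that])
    have lin: "linear_fun (\<alpha> m)" "\<And>i. i \<in> I \<Longrightarrow> linear_fun (\<alpha> i)" using insert.prems(1) by auto
    have y: "\<alpha> m y = -1" "\<gamma> y < 0"
      using neg x0 sc[OF lin(1)] sc[OF insert.prems(2)] by (auto simp: zero_less_divide_iff)
    have yI: "\<alpha> i y \<ge> 0" if "i \<in> I" for i
      using neg x0 sc[OF lin(2)[OF that]] that by (auto simp: divide_le_0_iff)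
    \<comment> \<open>Projection along \<open>y\<close> onto the kernel of
      \<open>\<alpha> m\<close>. There the constraint \<open>m\<close> holds trivially, so the
      induction hypothesis applies to the composed functionals.\<close>
    define pr where "pr = (\<lambda>x j. x j + \<alpha> m x * y j)"
    have pr: "f (pr x) = f x + \<alpha> m x * f y" if "linear_fun f" for f x
      unfolding pr_def by (rule linear_funD[OF that])
    have lpr: "linear_fun (\<lambda>x. f (pr x))" if "linear_fun f" for f
      unfolding linear_fun_def pr[OF that] linear_funD[OF that] linear_funD[OF lin(1)]
      by (simp add: algebra_simps)
    have "\<exists>c. (\<forall>i\<in>I. c i \<ge> 0) \<and> (\<forall>x. \<gamma> (pr x) = (\<Sum>i\<in>I. c i * \<alpha> i (pr x)))"
    proof (rule insert.IH[of "\<lambda>i x. \<alpha> i (pr x)" "\<lambda>x. \<gamma> (pr x)"])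
      fix x assume "\<And>i. i \<in> I \<Longrightarrow> 0 \<le> \<alpha> i (pr x)"
      then show "0 \<le> \<gamma> (pr x)"
        using pr[OF lin(1), of x] y(1) by (intro insert.prems(3)) auto
    qed (use insert.prems lpr in auto)
    then obtain c where c: "\<And>i. i \<in> I \<Longrightarrow> c i \<ge> 0" "\<And>x. \<gamma> (pr x) = (\<Sum>i\<in>I. c i * \<alpha> i (pr x))" by blast
    \<comment> \<open>The coefficient of \<open>\<alpha> m\<close> left over when the projection is
      undone; \<open>\<gamma> y < 0\<close> makes it positive.\<close>
    define d where "d = (\<Sum>i\<in>I. c i * \<alpha> i y) - \<gamma> y"
    have d: "d \<ge> 0" using y(2) sum_nonneg[of I "\<lambda>i. c i * \<alpha> i y"] c(1) yI by (simp add: d_def)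
    have "\<gamma> x = (\<Sum>i\<in>insert m I. (c(m := d)) i * \<alpha> i x)" for x
    proof -
      have "\<gamma> x + \<alpha> m x * \<gamma> y = (\<Sum>i\<in>I. c i * (\<alpha> i x + \<alpha> m x * \<alpha> i y))"
        using c(2)[of x] pr[OF insert.prems(2), of x] pr[OF lin(2), of _ x] by simp
      also have "\<dots> = (\<Sum>i\<in>I. c i * \<alpha> i x) + \<alpha> m x * (\<Sum>i\<in>I. c i * \<alpha> i y)"
        by (simp add: sum.distrib sum_distrib_left algebra_simps)
      finally have "\<gamma> x = d * \<alpha> m x + (\<Sum>i\<in>I. c i * \<alpha> i x)" by (simp add: d_def algebra_simps)
      also have "(\<Sum>i\<in>I. c i * \<alpha> i x) = (\<Sum>i\<in>I. (c(m := d)) i * \<alpha> i x)"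
        using insert.hyps by (intro sum.cong) auto
      finally show ?thesis using insert.hyps by simp
    qed
    then show ?thesis using c(1) d insert.hyps by (intro exI[of _ "c(m := d)"]) auto
  qed
qed

text \<open>Padding with zeros gives rectangular sums, which can be swapped and split along a
  cut.\<close>

lemma sum_arcs:
  fixes f :: "nat \<times> nat \<Rightarrow> real"
  assumes "finite V" "E \<subseteq> V \<times> V"
  shows "(\<Sum>e\<in>E. f e) = (\<Sum>i\<in>V. \<Sum>j\<in>V. if (i, j) \<in> E then f (i, j) else 0)"
    and "(\<Sum>j\<in>{j. (i, j) \<in> E}. f (i, j)) = (\<Sum>j\<in>V. if (i, j) \<in> E then f (i, j) else 0)"
    and "(\<Sum>i\<in>{i. (i, j) \<in> E}. f (i, j)) = (\<Sum>i\<in>V. if (i, j) \<in> E then f (i, j) else 0)"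
proof -
  have "(\<Sum>e\<in>E. f e) = (\<Sum>e\<in>V \<times> V. if e \<in> E then f e else 0)"
    using assms by (simp add: sum.inter_restrict[symmetric] Int_absorb1)
  then show "(\<Sum>e\<in>E. f e) = (\<Sum>i\<in>V. \<Sum>j\<in>V. if (i, j) \<in> E then f (i, j) else 0)"
    by (simp add: sum.cartesian_product split_def cong: if_cong)
  have "{j. (i, j) \<in> E} = {j \<in> V. (i, j) \<in> E}" "{i. (i, j) \<in> E} = {i \<in> V. (i, j) \<in> E}" for i j
    using assms(2) by auto
  then show "(\<Sum>j\<in>{j. (i, j) \<in> E}. f (i, j)) = (\<Sum>j\<in>V. if (i, j) \<in> E then f (i, j) else 0)"
    "(\<Sum>i\<in>{i. (i, j) \<in> E}. f (i, j)) = (\<Sum>i\<in>V. if (i, j) \<in> E then f (i, j) else 0)"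
    using assms(1) by (simp_all add: sum.inter_filter)
qed

text \<open>In the functionals below the variable \<open>Inl j\<close> stands for \<open>r j\<close>, \<open>Inr (Some j)\<close> for \<open>p j\<close>, and \<open>Inr None\<close> homogenises.\<close>
lemma circulation_duality:
  fixes w :: "nat \<Rightarrow> real" and d :: "nat \<Rightarrow> nat \<Rightarrow> real"
  assumes V: "finite V" "E \<subseteq> V \<times> V" and w: "\<And>i. i \<in> V \<Longrightarrow> 0 \<le> w i"
    and M: "\<And>F. F \<in> flows_v V E w \<Longrightarrow> (\<Sum>(i, j)\<in>E. F (i, j) * d i j) \<le> M"
  shows "\<exists>r p. (\<forall>j\<in>V. 0 \<le> r j) \<and> (\<forall>(i, j)\<in>E. d i j + p j - p i \<le> r j) \<and> (\<Sum>j\<in>V. w j * r j) \<le> M"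
proof (rule ccontr)
  assume contra: "\<not> ?thesis"
  define \<alpha> :: "(nat \<times> nat) + nat option \<Rightarrow> (nat + nat option \<Rightarrow> real) \<Rightarrow> real" where
    "\<alpha> = (\<lambda>c x. case c of
        Inl (i, j) \<Rightarrow> x (Inl j) + x (Inr (Some i)) - x (Inr (Some j)) - d i j * x (Inr None)
      | Inr (Some j) \<Rightarrow> x (Inl j)
      | Inr None \<Rightarrow> M * x (Inr None) - (\<Sum>j\<in>V. w j * x (Inl j)))"
  define I where "I = E <+> insert None (Some ` V)"
  have finE: "finite E" using V by (meson finite_SigmaI finite_subset)
  \<comment> \<open>A point of the cone with positive homogenising variable would, after division by
    it, give the \<open>r\<close> and \<open>p\<close> excluded by \<open>contra\<close>. Hence
    Farkas applies to the negative of that variable.\<close>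
  have "\<exists>c. (\<forall>i\<in>I. 0 \<le> c i) \<and> (\<forall>x. - x (Inr None) = (\<Sum>i\<in>I. c i * \<alpha> i x))"
  proof (rule farkas)
    show "finite I" using V finE by (simp add: I_def)
    show "linear_fun (\<alpha> c)" for c
      unfolding linear_fun_def \<alpha>_def
      by (auto simp: algebra_simps sum.distrib sum_distrib_left split: sum.splits option.splits)
    show "linear_fun (\<lambda>x :: nat + nat option \<Rightarrow> real. - x (Inr None))"
      by (simp add: linear_fun_def)
    fix x :: "nat + nat option \<Rightarrow> real"
    assume pos: "\<And>i. i \<in> I \<Longrightarrow> 0 \<le> \<alpha> i x"
    show "0 \<le> - x (Inr None)"
    proof (rule ccontr)
      assume "\<not> ?thesis"
      then have t: "x (Inr None) > 0" by simp
      let ?t = "x (Inr None)"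
      have "(\<forall>j\<in>V. 0 \<le> x (Inl j) / ?t)"
      proof
        fix j assume "j \<in> V"
        then show "0 \<le> x (Inl j) / ?t" using pos[of "Inr (Some j)"] t by (simp add: I_def \<alpha>_def InrI)
      qed
      moreover have "d i j + x (Inr (Some j)) / ?t - x (Inr (Some i)) / ?t \<le> x (Inl j) / ?t"
        if "(i, j) \<in> E" for i j
      proof -
        have "d i j * ?t + x (Inr (Some j)) - x (Inr (Some i)) \<le> x (Inl j)"
          using pos[of "Inl (i, j)"] that by (simp add: I_def \<alpha>_def InlI)
        then have "(d i j * ?t + x (Inr (Some j)) - x (Inr (Some i))) / ?t \<le> x (Inl j) / ?t"
          using t by (intro divide_right_mono) auto
        then show ?thesis using t by (simp add: add_divide_distrib diff_divide_distrib)
      qed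
      moreover have "(\<Sum>j\<in>V. w j * (x (Inl j) / ?t)) \<le> M"
        using pos[of "Inr None"] t by (simp add: I_def \<alpha>_def InrI sum_divide_distrib[symmetric] field_simps)
      ultimately have "(\<forall>j\<in>V. 0 \<le> x (Inl j) / ?t) \<and>
          (\<forall>(i, j)\<in>E. d i j + x (Inr (Some j)) / ?t - x (Inr (Some i)) / ?t \<le> x (Inl j) / ?t) \<and>
          (\<Sum>j\<in>V. w j * (x (Inl j) / ?t)) \<le> M"
        by blast
      then show False using contra by (elim notE, intro exI) assumption
    qed
  qed
  then obtain c where c0: "\<And>i. i \<in> I \<Longrightarrow> 0 \<le> c i" and c: "\<And>x. - x (Inr None) = (\<Sum>i\<in>I. c i * \<alpha> i x)"
    by blast
  \<comment> \<open>Multipliers: \<open>F\<close> on the arcs, \<open>z\<close> on the budget, and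
    \<open>c (Inr (Some j))\<close> as slack in the capacity of \<open>j\<close>.\<close>
  define z where "z = c (Inr None)"
  define F where "F e = c (Inl e)" for e
  have z0: "z \<ge> 0" and F0: "\<And>e. e \<in> E \<Longrightarrow> F e \<ge> 0" and s0: "\<And>j. j \<in> V \<Longrightarrow> c (Inr (Some j)) \<ge> 0"
    using c0 by (auto simp: I_def z_def F_def)
  have expand: "- x (Inr None) = (\<Sum>e\<in>E. F e * \<alpha> (Inl e) x) + z * \<alpha> (Inr None) x
      + (\<Sum>j\<in>V. c (Inr (Some j)) * x (Inl j))" for x
  proof -
    have "(\<Sum>i\<in>I. c i * \<alpha> i x) = (\<Sum>e\<in>E. c (Inl e) * \<alpha> (Inl e) x)
        + (\<Sum>j\<in>insert None (Some ` V). c (Inr j) * \<alpha> (Inr j) x)"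
      unfolding I_def using finE V by (subst sum.Plus) auto
    also have "(\<Sum>j\<in>insert None (Some ` V). c (Inr j) * \<alpha> (Inr j) x)
        = z * \<alpha> (Inr None) x + (\<Sum>j\<in>V. c (Inr (Some j)) * \<alpha> (Inr (Some j)) x)"
      using V by (subst sum.insert) (auto simp: z_def sum.reindex)
    finally show ?thesis using c[of x] by (simp add: F_def \<alpha>_def)
  qed
  \<comment> \<open>Unit vectors read the flow conditions off \<open>expand\<close>:
    \<open>r\<close> coordinates give capacity, \<open>p\<close> coordinates conservation, and the
    homogenising coordinate the value.\<close>
  let ?u = "\<lambda>a. (\<lambda>_. 0 :: real)(a := 1)"
  have delta: "(\<Sum>e\<in>E. F e * (if snd e = k then 1 else 0)) = (\<Sum>i\<in>{i. (i, k) \<in> E}. F (i, k))"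
    "(\<Sum>e\<in>E. F e * (if fst e = k then 1 else 0)) = (\<Sum>i\<in>{i. (k, i) \<in> E}. F (k, i))" if "k \<in> V" for k
  proof -
    have "(\<Sum>i\<in>V. \<Sum>j\<in>V. if (i, j) \<in> E then F (i, j) * (if j = k then 1 else 0) else 0)
        = (\<Sum>i\<in>V. \<Sum>j\<in>V. if j = k then (if (i, k) \<in> E then F (i, k) else 0) else 0)"
      by (intro sum.cong) auto
    then show "(\<Sum>e\<in>E. F e * (if snd e = k then 1 else 0)) = (\<Sum>i\<in>{i. (i, k) \<in> E}. F (i, k))"
      using that V(1) by (simp add: sum_arcs[OF V] cong: if_cong)
    have "(\<Sum>i\<in>V. \<Sum>j\<in>V. if (i, j) \<in> E then F (i, j) * (if i = k then 1 else 0) else 0)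
        = (\<Sum>i\<in>V. if i = k then (\<Sum>j\<in>V. if (k, j) \<in> E then F (k, j) else 0) else 0)"
      by (intro sum.cong) (auto cong: if_cong)
    then show "(\<Sum>e\<in>E. F e * (if fst e = k then 1 else 0)) = (\<Sum>i\<in>{i. (k, i) \<in> E}. F (k, i))"
      using that V(1) by (simp add: sum_arcs[OF V] cong: if_cong)
  qed
  have inflow: "(\<Sum>i\<in>{i. (i, k) \<in> E}. F (i, k)) = z * w k - c (Inr (Some k))" if k: "k \<in> V" for k
  proof -
    have "\<alpha> (Inl e) (?u (Inl k)) = (if snd e = k then 1 else 0)" for e
      by (cases e) (simp add: \<alpha>_def)
    moreover have "\<alpha> (Inr None) (?u (Inl k)) = - w k"
      using k V by (simp add: \<alpha>_def if_distrib[of "\<lambda>x. _ * x"] cong: if_cong)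
    moreover have "(\<Sum>j\<in>V. c (Inr (Some j)) * ?u (Inl k) (Inl j)) = c (Inr (Some k))"
      using k V by (simp add: if_distrib[of "\<lambda>x. _ * x"] cong: if_cong)
    ultimately show ?thesis using expand[of "?u (Inl k)"] delta(1)[OF k] by simp
  qed
  have conserve: "(\<Sum>i\<in>{i. (k, i) \<in> E}. F (k, i)) = (\<Sum>i\<in>{i. (i, k) \<in> E}. F (i, k))" if k: "k \<in> V" for k
  proof -
    have "\<alpha> (Inl e) (?u (Inr (Some k))) = (if fst e = k then 1 else 0) - (if snd e = k then 1 else 0)" for e
      by (cases e) (simp add: \<alpha>_def)
    moreover have "\<alpha> (Inr None) (?u (Inr (Some k))) = 0" by (simp add: \<alpha>_def)
    ultimately show ?thesis using expand[of "?u (Inr (Some k))"] delta[OF k]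
      by (simp add: right_diff_distrib sum_subtractf)
  qed
  have total: "(\<Sum>(i, j)\<in>E. F (i, j) * d i j) = z * M + 1"
  proof -
    have "\<alpha> (Inl e) (?u (Inr None)) = - d (fst e) (snd e)" for e by (cases e) (simp add: \<alpha>_def)
    moreover have "\<alpha> (Inr None) (?u (Inr None)) = M" by (simp add: \<alpha>_def)
    ultimately show ?thesis using expand[of "?u (Inr None)"]
      by (simp add: sum_negf case_prod_beta)
  qed
  \<comment> \<open>If \<open>z = 0\<close>, capacities force the flow to vanish although its value
    is 1. Otherwise \<open>F / z\<close> is feasible with value \<open>M + 1 / z\<close>.\<close>
  show False
  proof (cases "z = 0")
    case True
    have "F (i, k) = 0" if "(i, k) \<in> E" for i k
    proof -
      have k: "k \<in> V" using that V by auto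
      have fin: "finite {i. (i, k) \<in> E}" using V by (auto intro: finite_subset[of _ V])
      have "F (i, k) \<le> (\<Sum>i\<in>{i. (i, k) \<in> E}. F (i, k))"
        using that F0 fin by (intro member_le_sum[of i _ "\<lambda>i. F (i, k)"]) auto
      also have "\<dots> \<le> 0" using inflow[OF k] True s0[OF k] by simp
      finally show ?thesis using F0[OF that] by simp
    qed
    then have "(\<Sum>(i, j)\<in>E. F (i, j) * d i j) = 0" by (intro sum.neutral) auto
    then show False using total True by simp
  next
    case False
    then have z: "z > 0" using z0 by simp
    have "(\<lambda>e. F e / z) \<in> flows_v V E w"
      unfolding flows_v_def using F0 z inflow conserve s0
      by (auto simp: sum_divide_distrib[symmetric] divide_le_eq mult.commute)
    from M[OF this] have "(\<Sum>(i, j)\<in>E. F (i, j) * d i j) / z \<le> M"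
      by (simp add: sum_divide_distrib case_prod_beta)
    then show False using total z by (simp add: divide_le_eq mult.commute)
  qed
qed

subsection \<open>Sweep cuts\<close>

text \<open>Integrate the threshold inequality over \<open>\<theta>\<close>: the indicator intervals
  have lengths \<open>t j\<close> and \<open>r j\<close>.\<close>

lemma layer_cake:
  fixes w t r lo :: "'a \<Rightarrow> real"
  assumes V: "finite V" and nonneg: "\<And>j. j \<in> V \<Longrightarrow> 0 \<le> w j \<and> 0 \<le> t j \<and> 0 \<le> r j"
    and c: "0 \<le> C" and le: "\<And>\<theta>. 0 \<le> \<theta> \<Longrightarrow>
      c * (\<Sum>j\<in>{j \<in> V. \<theta> < t j}. w j) \<le> C * (\<Sum>j\<in>{j \<in> V. lo j \<le> \<theta> \<and> \<theta> < lo j + r j}. w j)"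
  shows "c * (\<Sum>j\<in>V. w j * t j) \<le> C * (\<Sum>j\<in>V. w j * r j)"
proof -
  let ?f = "\<lambda>\<theta>. c * (\<Sum>j\<in>V. w j * indicator {0..<t j} \<theta>)"
  let ?g = "\<lambda>\<theta>. C * (\<Sum>j\<in>V. w j * indicator {lo j..<lo j + r j} \<theta>) :: real"
  have int: "integrable lborel (\<lambda>\<theta>. w j * indicator {a..<b} \<theta> :: real)" for a b :: real and j
    by (intro integrable_mult_right integrable_real_indicator) (auto, cases "a \<le> b", auto)
  have "?f \<theta> \<le> ?g \<theta>" for \<theta>
  proof (cases "0 \<le> \<theta>")
    case True
    have "(\<Sum>j\<in>V. w j * indicator {0..<t j} \<theta>) = (\<Sum>j\<in>{j \<in> V. \<theta> < t j}. w j)"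
      unfolding sum.inter_filter[OF V] using True by (intro sum.cong) (auto simp: indicator_def)
    moreover have "(\<Sum>j\<in>V. w j * indicator {lo j..<lo j + r j} \<theta>)
        = (\<Sum>j\<in>{j \<in> V. lo j \<le> \<theta> \<and> \<theta> < lo j + r j}. w j)"
      unfolding sum.inter_filter[OF V] by (intro sum.cong) (auto simp: indicator_def)
    ultimately show ?thesis using le[OF True] by simp
  next
    case False
    \<comment> \<open>At negative thresholds the left side vanishes, while the right may not, as
      \<open>lo\<close> can be negative.\<close>
    then have "?f \<theta> = 0" by (auto simp: indicator_def intro!: sum.neutral)
    moreover have "0 \<le> ?g \<theta>" using nonneg c by (intro mult_nonneg_nonneg sum_nonneg) auto
    ultimately show ?thesis by linarith
  qed
  then have "integral\<^sup>L lborel ?f \<le> integral\<^sup>L lborel ?g"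
    using int by (intro integral_mono integrable_mult_right integrable_sum) auto
  moreover have "integral\<^sup>L lborel ?f = c * (\<Sum>j\<in>V. w j * t j)"
    using int nonneg by (simp add: Bochner_Integration.integral_sum)
  moreover have "integral\<^sup>L lborel ?g = C * (\<Sum>j\<in>V. w j * r j)"
    using int nonneg by (simp add: Bochner_Integration.integral_sum)
  ultimately show ?thesis by linarith
qed

locale weighted_digraph =
  fixes V :: "nat set" and E :: "(nat \<times> nat) set" and w :: "nat \<Rightarrow> real"
  assumes finV: "finite V" and cardV: "card V \<ge> 2" and EV: "E \<subseteq> V \<times> V"
    and w_pos: "\<And>i. i \<in> V \<Longrightarrow> w i > 0"
begin

abbreviation "cuts \<equiv> {S. S \<subseteq> V \<and> S \<noteq> {} \<and> S \<noteq> V}"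

lemma cuts: "finite cuts" "cuts \<noteq> {}"
proof -
  show "finite cuts" using finV by (auto intro: finite_subset[of _ "Pow V"])
  obtain a where "a \<in> V" using cardV by fastforce
  then have "{a} \<in> cuts" using cardV by auto
  then show "cuts \<noteq> {}" by blast
qed

lemma wt_pos: "S \<subseteq> V \<Longrightarrow> S \<noteq> {} \<Longrightarrow> wt w S > 0"
  unfolding wt_def using w_pos finV by (intro sum_pos) (auto intro: finite_subset)

lemma wt_nonneg: "S \<subseteq> V \<Longrightarrow> wt w S \<ge> 0"
  unfolding wt_def using w_pos by (intro sum_nonneg) (auto intro: less_imp_le)

lemma wt_mono: "S \<subseteq> T \<Longrightarrow> T \<subseteq> V \<Longrightarrow> wt w S \<le> wt w T"
  unfolding wt_def using w_pos finV by (intro sum_mono2) (auto intro: finite_subset less_imp_le)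

lemma wt_compl: "S \<subseteq> V \<Longrightarrow> wt w V = wt w S + wt w (V - S)"
  unfolding wt_def using finV by (simp add: sum.subset_diff)

lemma out_bd_subset: "out_bd V E S \<subseteq> V"
  by (auto simp: out_bd_def)

lemma psi_graph_nonneg: "psi_graph V E w \<ge> 0"
  unfolding psi_graph_def using cuts wt_nonneg out_bd_subset
  by (subst Min_ge_iff) (auto simp: psi_set_def)

text \<open>Clearing denominators by \<open>min a b * max a b = a * b\<close> and
  \<open>max a b \<le> wt w V\<close> gives a product form that also covers the trivial cuts.
  \<open>T\<close> selects which of the two boundaries is charged.\<close>

lemma psi_cut:
  assumes "S \<subseteq> V" "T = S \<or> T = V - S"
  shows "psi_graph V E w * (wt w S * wt w (V - S)) \<le> wt w V * wt w (out_bd V E T)"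
proof (cases "S = {} \<or> S = V")
  case True
  then show ?thesis using wt_nonneg[OF out_bd_subset, of T] wt_nonneg[of V] by (auto simp: wt_def)
next
  case False
  let ?a = "wt w S" and ?b = "wt w (V - S)" and ?o = "wt w (out_bd V E T)"
  have ab: "?a > 0" "?b > 0" using wt_pos[of S] wt_pos[of "V - S"] assms False by auto
  have "psi_graph V E w \<le> psi_set V E w S"
    unfolding psi_graph_def using cuts(1) assms(1) False by (intro Min_le) auto
  also have "\<dots> \<le> ?o / min ?a ?b"
    unfolding psi_set_def using assms(2) ab by (intro divide_right_mono) auto
  finally have "psi_graph V E w * (?a * ?b) \<le> ?o / min ?a ?b * (?a * ?b)"
    using ab by (intro mult_right_mono) auto
  also have "\<dots> = ?o * max ?a ?b" using ab by (auto simp: min_def max_def)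
  also have "\<dots> \<le> ?o * wt w V"
    using wt_compl[OF assms(1)] ab wt_nonneg[OF out_bd_subset] by (intro mult_left_mono) auto
  finally show ?thesis by (simp add: mult.commute)
qed

text \<open>All level sets \<open>t j \<le> \<theta>\<close> with \<open>\<theta> \<ge> 0\<close>
  contain \<open>Z\<close>. Each vertex \<open>j\<close> lies on the boundary only for thresholds in
  an interval of length \<open>r j\<close>, so integration compares \<open>t\<close> with
  \<open>r\<close>.\<close>

lemma sweep:
  assumes t: "\<And>j. j \<in> V \<Longrightarrow> 0 \<le> t j" and r: "\<And>j. j \<in> V \<Longrightarrow> 0 \<le> r j"
    and Z: "Z \<subseteq> V" "\<And>j. j \<in> Z \<Longrightarrow> t j = 0"
    and lip: "(\<forall>(i, j)\<in>E. t j \<le> t i + r j) \<or> (\<forall>(i, j)\<in>E. t i \<le> t j + r j)"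
  shows "psi_graph V E w * wt w Z * (\<Sum>j\<in>V. w j * t j) \<le> wt w V * (\<Sum>j\<in>V. w j * r j)"
proof -
  have core: "psi_graph V E w * wt w Z * (\<Sum>j\<in>V. w j * t j) \<le> wt w V * (\<Sum>j\<in>V. w j * r j)"
    if T: "\<And>\<theta>. T \<theta> = {j \<in> V. t j \<le> \<theta>} \<or> T \<theta> = V - {j \<in> V. t j \<le> \<theta>}"
      and bd: "\<And>\<theta>. out_bd V E (T \<theta>) \<subseteq> {j \<in> V. lo j \<le> \<theta> \<and> \<theta> < lo j + r j}" for T lo
  proof (rule layer_cake)
    fix \<theta> :: real assume "0 \<le> \<theta>"
    let ?S = "{j \<in> V. t j \<le> \<theta>}"
    have V_S: "{j \<in> V. \<theta> < t j} = V - ?S" by auto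
    have "psi_graph V E w * wt w Z * wt w (V - ?S) \<le> psi_graph V E w * (wt w ?S * wt w (V - ?S))"
      unfolding mult.assoc using Z \<open>0 \<le> \<theta>\<close> psi_graph_nonneg wt_nonneg[of "V - ?S"]
      by (intro mult_left_mono mult_right_mono wt_mono) auto
    also have "\<dots> \<le> wt w V * wt w (out_bd V E (T \<theta>))"
      using T by (intro psi_cut) auto
    also have "\<dots> \<le> wt w V * wt w {j \<in> V. lo j \<le> \<theta> \<and> \<theta> < lo j + r j}"
      using bd wt_nonneg by (intro mult_left_mono wt_mono) auto
    finally show "psi_graph V E w * wt w Z * (\<Sum>j\<in>{j \<in> V. \<theta> < t j}. w j)
        \<le> wt w V * (\<Sum>j\<in>{j \<in> V. lo j \<le> \<theta> \<and> \<theta> < lo j + r j}. w j)"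
      unfolding V_S wt_def .
  qed (use finV t r w_pos wt_nonneg in \<open>auto intro: less_imp_le\<close>)
  from lip show ?thesis
  proof
    \<comment> \<open>A vertex entered from the sublevel set satisfies
      \<open>t j - r j \<le> \<theta> < t j\<close>.\<close>
    assume *: "\<forall>(i, j)\<in>E. t j \<le> t i + r j"
    show ?thesis
      by (rule core[of "\<lambda>\<theta>. {j \<in> V. t j \<le> \<theta>}" "\<lambda>j. t j - r j"])
        (use * in \<open>fastforce simp: out_bd_def\<close>)+
  next
    \<comment> \<open>Here arcs leave the superlevel set, and their heads satisfy
      \<open>t j \<le> \<theta> < t j + r j\<close>.\<close>
    assume *: "\<forall>(i, j)\<in>E. t i \<le> t j + r j"
    show ?thesis
      by (rule core[of "\<lambda>\<theta>. V - {j \<in> V. t j \<le> \<theta>}" t])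
        (use * in \<open>fastforce simp: out_bd_def\<close>)+
  qed
qed

text \<open>Take the least value of \<open>p\<close> on \<open>A\<close> whose sublevel set holds
  half the weight; by minimality the strictly smaller values hold at most half.\<close>

lemma weighted_median:
  fixes p :: "nat \<Rightarrow> real"
  assumes "A \<subseteq> V" "A \<noteq> {}"
  shows "\<exists>m. wt w A / 2 \<le> wt w {i \<in> A. p i \<le> m} \<and> wt w A / 2 \<le> wt w {i \<in> A. m \<le> p i}"
proof -
  have finA: "finite A" using assms finV finite_subset by blast
  let ?X = "{m \<in> p ` A. wt w A / 2 \<le> wt w {i \<in> A. p i \<le> m}}"
  have "{i \<in> A. p i \<le> Max (p ` A)} = A" using finA by auto
  then have "Max (p ` A) \<in> ?X" using finA assms wt_nonneg[of A] by auto
  then have X: "finite ?X" "?X \<noteq> {}" using finA by auto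
  define m where "m = Min ?X"
  have m: "m \<in> ?X" unfolding m_def using X by (rule Min_in)
  have "wt w {i \<in> A. p i < m} \<le> wt w A / 2"
  proof (cases "{i \<in> A. p i < m} = {}")
    case True
    then show ?thesis using wt_nonneg[OF assms(1)] by (simp only: True) (simp add: wt_def)
  next
    case False
    let ?B = "p ` {i \<in> A. p i < m}"
    let ?x = "Max ?B"
    have x: "?x \<in> ?B" using False finA by (intro Max_in) auto
    have "p i \<le> ?x" if "i \<in> A" "p i < m" for i using that finA by (intro Max_ge) auto
    then have "{i \<in> A. p i < m} = {i \<in> A. p i \<le> ?x}" using x by auto
    moreover have "?x \<notin> ?X" using Min_le[OF X(1), of ?x] x unfolding m_def[symmetric] by auto
    ultimately show ?thesis using x by auto
  qed
  moreover have "wt w A = wt w {i \<in> A. p i < m} + wt w {i \<in> A. m \<le> p i}"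
    unfolding wt_def using finA by (subst sum.union_disjoint[symmetric]) (auto intro!: sum.cong)
  ultimately show ?thesis using m by (intro exI[of _ m]) auto
qed

text \<open>Split \<open>A\<close> at the median of the potential \<open>p\<close>: vertices of potential above it are far from
  the lower half in the quasimetric \<open>d i j + p j - p i\<close>, the others are far to the upper half.\<close>
lemma potential_sweep:
  assumes A: "A \<subseteq> V"
    and d: "\<And>i. i \<in> V \<Longrightarrow> d i i = 0"
      "\<And>i j k. \<lbrakk>i \<in> V; j \<in> V; k \<in> V\<rbrakk> \<Longrightarrow> d i k \<le> d i j + d j k"
      "\<And>i j. d i j = d j i"
    and \<delta>: "\<And>i j. \<lbrakk>i \<in> A; j \<in> V\<rbrakk> \<Longrightarrow> \<delta> j \<le> d i j" "\<And>j. j \<in> V \<Longrightarrow> 0 \<le> \<delta> j"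
    and r: "\<And>j. j \<in> V \<Longrightarrow> 0 \<le> r j" "\<And>i j. (i, j) \<in> E \<Longrightarrow> d i j + p j - p i \<le> r j"
  shows "psi_graph V E w * wt w A * (\<Sum>j\<in>V. w j * \<delta> j) \<le> 4 * wt w V * (\<Sum>j\<in>V. w j * r j)"
proof (cases "A = {}")
  case True
  have "0 \<le> (\<Sum>j\<in>V. w j * r j)"
    using r(1) w_pos by (intro sum_nonneg mult_nonneg_nonneg) (auto intro: less_imp_le)
  then show ?thesis using True wt_nonneg[of V] by (simp add: wt_def[of w "{}"])
next
  case False
  obtain m where m: "wt w A / 2 \<le> wt w {i \<in> A. p i \<le> m}" "wt w A / 2 \<le> wt w {i \<in> A. m \<le> p i}"
    using weighted_median[OF A False] by blast
  define B where "B = {i \<in> A. p i \<le> m}"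
  define C where "C = {i \<in> A. m \<le> p i}"
  have wA: "wt w A > 0" using wt_pos[OF A False] .
  have ne: "B \<noteq> {}" "C \<noteq> {}" using m wA unfolding B_def[symmetric] C_def[symmetric] by (auto simp: wt_def)
  have BC: "B \<subseteq> V" "C \<subseteq> V" "finite B" "finite C"
    using A finV finite_subset[of _ V] by (auto simp: B_def C_def)
  \<comment> \<open>Distance from \<open>B\<close> in the quasimetric, cut off at 0 since potential
    differences can make it negative; \<open>t'\<close> is likewise the distance to
    \<open>C\<close>.\<close>
  define t where "t j = max 0 (Min ((\<lambda>i. d i j + p j - p i) ` B))" for j
  define t' where "t' j = max 0 (Min ((\<lambda>i. d j i + p i - p j) ` C))" for j
  have t_le: "t j \<le> max 0 (d i j + p j - p i)" if "i \<in> B" for i j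
    unfolding t_def using that BC by (intro max.mono Min_le) auto
  have t'_le: "t' j \<le> max 0 (d j i + p i - p j)" if "i \<in> C" for i j
    unfolding t'_def using that BC by (intro max.mono Min_le) auto
  have t_ex: "\<exists>i\<in>B. t j = max 0 (d i j + p j - p i)" for j
  proof -
    have "Min ((\<lambda>i. d i j + p j - p i) ` B) \<in> (\<lambda>i. d i j + p j - p i) ` B"
      using ne BC by (intro Min_in) auto
    then show ?thesis unfolding t_def by auto
  qed
  have t'_ex: "\<exists>i\<in>C. t' j = max 0 (d j i + p i - p j)" for j
  proof -
    have "Min ((\<lambda>i. d j i + p i - p j) ` C) \<in> (\<lambda>i. d j i + p i - p j) ` C"
      using ne BC by (intro Min_in) auto
    then show ?thesis unfolding t'_def by auto
  qed
  have lip: "t k \<le> t j + r k \<and> t' j \<le> t' k + r k" if jk: "(j, k) \<in> E" for j k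
  proof
    have V: "j \<in> V" "k \<in> V" using jk EV by auto
    obtain i where i: "i \<in> B" "t j = max 0 (d i j + p j - p i)" using t_ex by blast
    then show "t k \<le> t j + r k"
      using t_le[OF i(1), of k] d(2)[of i j k] r(1)[of k] r(2)[OF jk] V BC by (auto simp: max_def split: if_splits)
    obtain i where i: "i \<in> C" "t' k = max 0 (d k i + p i - p k)" using t'_ex by blast
    then show "t' j \<le> t' k + r k"
      using t'_le[OF i(1), of j] d(2)[of j k i] r(1)[of k] r(2)[OF jk] V BC by (auto simp: max_def split: if_splits)
  qed
  have psi: "psi_graph V E w \<ge> 0" by (rule psi_graph_nonneg)
  let ?R = "wt w V * (\<Sum>j\<in>V. w j * r j)"
  have "t j = 0" if "j \<in> B" for j using t_le[OF that, of j] d(1)[of j] that BC by (auto simp: t_def)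
  then have s1: "psi_graph V E w * wt w B * (\<Sum>j\<in>V. w j * t j) \<le> ?R"
    using r(1) BC lip by (intro sweep) (auto simp: t_def)
  have "t' j = 0" if "j \<in> C" for j using t'_le[OF that, of j] d(1)[of j] that BC by (auto simp: t'_def)
  then have s2: "psi_graph V E w * wt w C * (\<Sum>j\<in>V. w j * t' j) \<le> ?R"
    using r(1) BC lip by (intro sweep) (auto simp: t'_def)
  have nonneg: "0 \<le> (\<Sum>j\<in>V. w j * t j)" "0 \<le> (\<Sum>j\<in>V. w j * t' j)"
    by (auto intro!: sum_nonneg mult_nonneg_nonneg simp: t_def t'_def less_imp_le[OF w_pos])
  have h1: "psi_graph V E w * (wt w A / 2) * (\<Sum>j\<in>V. w j * t j) \<le> ?R"
    using m(1) psi nonneg unfolding B_def[symmetric]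
    by (intro order_trans[OF _ s1] mult_right_mono mult_left_mono) auto
  have h2: "psi_graph V E w * (wt w A / 2) * (\<Sum>j\<in>V. w j * t' j) \<le> ?R"
    using m(2) psi nonneg unfolding C_def[symmetric]
    by (intro order_trans[OF _ s2] mult_right_mono mult_left_mono) auto
  have "\<delta> j \<le> t j + t' j" if j: "j \<in> V" for j
  proof (cases "m \<le> p j")
    case True
    obtain i where "i \<in> B" "t j = max 0 (d i j + p j - p i)" using t_ex by blast
    then show ?thesis using \<delta>(1)[of i j] j True by (auto simp: B_def t'_def)
  next
    case False
    obtain i where "i \<in> C" "t' j = max 0 (d j i + p i - p j)" using t'_ex by blast
    then show ?thesis using \<delta>(1)[of i j] j False d(3)[of i j] by (auto simp: C_def t_def)
  qed
  then have "(\<Sum>j\<in>V. w j * \<delta> j) \<le> (\<Sum>j\<in>V. w j * (t j + t' j))"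
    using w_pos by (intro sum_mono mult_left_mono) (auto intro: less_imp_le)
  then have "psi_graph V E w * wt w A * (\<Sum>j\<in>V. w j * \<delta> j)
      \<le> psi_graph V E w * wt w A * ((\<Sum>j\<in>V. w j * t j) + (\<Sum>j\<in>V. w j * t' j))"
    using psi wA by (intro mult_left_mono) (auto simp: distrib_left sum.distrib)
  \<comment> \<open>One factor 2 comes from halving \<open>A\<close>, the other from adding the two
    sweeps.\<close>
  also have "\<dots> \<le> 4 * ?R" using h1 h2 by (simp add: algebra_simps)
  finally show ?thesis by simp
qed

section \<open>Flow energy and the embedding of a cut\<close>

lemma flows_nonempty: "(\<lambda>_. 0) \<in> flows_v V E w"
  using w_pos by (auto simp: flows_v_def intro: less_imp_le)

lemma flow_le:
  assumes F: "F \<in> flows_v V E w" and ij: "(i, j) \<in> E"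
  shows "F (i, j) \<le> w i"
proof -
  have i: "i \<in> V" using ij EV by auto
  have "finite {j. (i, j) \<in> E}" using finV EV by (auto intro: finite_subset[of _ V])
  then have "F (i, j) \<le> (\<Sum>j\<in>{j. (i, j) \<in> E}. F (i, j))"
    using F ij by (intro member_le_sum[of j _ "\<lambda>j. F (i, j)"]) (auto simp: flows_v_def)
  also have "\<dots> \<le> w i" using F i by (auto simp: flows_v_def)
  finally show ?thesis .
qed

lemma sqdist_nonneg: "0 \<le> sqdist n x y"
  by (simp add: sqdist_def sum_nonneg)

text \<open>Capacities bound the flow on every arc. Boundedness is what makes the real supremum an
  upper bound of the energies.\<close>

lemma energy_bdd: "bdd_above ((\<lambda>F. flow_energy V E F v) ` flows_v V E w)"
proof (rule bdd_aboveI2)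
  fix F assume F: "F \<in> flows_v V E w"
  show "flow_energy V E F v \<le> (1/2) * (\<Sum>(i, j)\<in>E. w i * sqdist (card V) (v i) (v j))"
    unfolding flow_energy_def using flow_le[OF F]
    by (intro mult_left_mono sum_mono) (auto intro!: mult_right_mono sqdist_nonneg)
qed

lemma SUP_energy_nonneg: "0 \<le> (SUP F\<in>flows_v V E w. flow_energy V E F v)"
  using flows_nonempty by (intro cSUP_upper2[OF energy_bdd]) (auto simp: flow_energy_def)

text \<open>Conservation summed over \<open>S\<close> cancels the inner arcs, so equal amounts cross
  in both directions. Each crossing unit enters a boundary vertex, whose inflow is capped by its
  weight, and the equality allows either boundary.\<close>

lemma flow_across_cut:
  assumes F: "F \<in> flows_v V E w" and S: "S \<subseteq> V"
  defines "X \<equiv> \<lambda>A B. \<Sum>i\<in>A. \<Sum>j\<in>B. if (i, j) \<in> E then F (i, j) else 0"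
  shows "X S (V - S) = X (V - S) S"
    and "X S (V - S) \<le> min (wt w (out_bd V E S)) (wt w (out_bd V E (V - S)))"
proof -
  define f where "f i j = (if (i, j) \<in> E then F (i, j) else 0)" for i j
  have X: "X A B = (\<Sum>i\<in>A. \<Sum>j\<in>B. f i j)" for A B by (simp add: X_def f_def)
  have f0: "f i j \<ge> 0" for i j using F by (auto simp: f_def flows_v_def)
  have cons: "(\<Sum>j\<in>V. f i j) = (\<Sum>j\<in>V. f j i)" and cap: "(\<Sum>j\<in>V. f j i) \<le> w i" if "i \<in> V" for i
    using F that unfolding flows_v_def f_def by (auto simp: sum_arcs[OF finV EV])
  have finS: "finite S" "finite (V - S)" using S finV finite_subset by auto
  have split: "(\<Sum>j\<in>V. g j) = (\<Sum>j\<in>S. g j) + (\<Sum>j\<in>V - S. g j)" for g :: "nat \<Rightarrow> real"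
    using S finV by (simp add: sum.subset_diff)
  have "X S S + X S (V - S) = (\<Sum>i\<in>S. \<Sum>j\<in>V. f i j)"
    unfolding X split by (simp add: sum.distrib)
  also have "\<dots> = (\<Sum>i\<in>S. \<Sum>j\<in>V. f j i)" using S by (intro sum.cong refl cons) auto
  also have "\<dots> = (\<Sum>i\<in>S. \<Sum>j\<in>S. f j i) + (\<Sum>i\<in>S. \<Sum>j\<in>V - S. f j i)"
    unfolding split by (simp add: sum.distrib)
  also have "(\<Sum>i\<in>S. \<Sum>j\<in>S. f j i) = X S S" unfolding X by (rule sum.swap)
  also have "(\<Sum>i\<in>S. \<Sum>j\<in>V - S. f j i) = X (V - S) S" unfolding X by (rule sum.swap)
  finally show eq: "X S (V - S) = X (V - S) S" by simp
  have bound: "X A (V - A) \<le> wt w (out_bd V E A)" if A: "A \<subseteq> V" for A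
  proof -
    have sub: "out_bd V E A \<subseteq> V - A" by (auto simp: out_bd_def)
    have "X A (V - A) = (\<Sum>j\<in>V - A. \<Sum>i\<in>A. f i j)" unfolding X by (rule sum.swap)
    also have "\<dots> = (\<Sum>j\<in>out_bd V E A. \<Sum>i\<in>A. f i j)"
      using sub finV by (intro sum.mono_neutral_right) (auto simp: out_bd_def f_def intro!: sum.neutral)
    also have "\<dots> \<le> (\<Sum>j\<in>out_bd V E A. \<Sum>i\<in>V. f i j)"
      using A finV f0 by (intro sum_mono sum_mono2) auto
    also have "\<dots> \<le> wt w (out_bd V E A)"
      unfolding wt_def using cap out_bd_subset by (intro sum_mono) auto
    finally show ?thesis .
  qed
  have "V - (V - S) = S" using S by auto
  then show "X S (V - S) \<le> min (wt w (out_bd V E S)) (wt w (out_bd V E (V - S)))"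
    using bound[OF S] bound[of "V - S"] eq by auto
qed

text \<open>Two-valued embedding: \<open>s * w(V - S)\<close> on \<open>S\<close> and \<open>- s * w(S)\<close> elsewhere, with
  \<open>s = 1 / sqrt (w(S) * w(V - S) * w(V))\<close>.\<close>
lemma cut_embedding:
  assumes S: "S \<in> cuts"
  shows "\<exists>v\<in>embeddings V w. (SUP F\<in>flows_v V E w. flow_energy V E F v) \<le> 2 * psi_set V E w S"
proof -
  define a where "a = wt w S"
  define b where "b = wt w (V - S)"
  have ab: "a > 0" "b > 0" using wt_pos[of S] wt_pos[of "V - S"] S by (auto simp: a_def b_def)
  define s where "s = 1 / sqrt (a * b * (a + b))"
  have s2: "s\<^sup>2 * (a * b * (a + b)) = 1" using ab by (simp add: s_def power_divide)
  define h where "h i = (if i \<in> S then s * b else - s * a)" for i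
  define v :: "nat \<Rightarrow> nat \<Rightarrow> real" where "v i k = (if k = 0 then h i else 0)" for i k
  let ?n = "card V"
  have n: "0 < ?n" using cardV by simp
  have dist: "sqdist ?n (v i) (v j) = (h i - h j)\<^sup>2" for i j
  proof -
    have "sqdist ?n (v i) (v j) = (\<Sum>k<?n. if k = 0 then (h i - h j)\<^sup>2 else 0)"
      unfolding sqdist_def v_def by (intro sum.cong) auto
    then show ?thesis using n by simp
  qed
  have norm: "sqnorm ?n (v i) = (h i)\<^sup>2" for i
  proof -
    have "sqnorm ?n (v i) = (\<Sum>k<?n. if k = 0 then (h i)\<^sup>2 else 0)"
      unfolding sqnorm_def v_def by (intro sum.cong) auto
    then show ?thesis using n by simp
  qed
  have split: "(\<Sum>i\<in>V. w i * (if i \<in> S then x else y)) = a * x + b * y" for x y :: real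
  proof -
    have "(\<Sum>i\<in>V. w i * (if i \<in> S then x else y)) = (\<Sum>i\<in>S. w i * x) + (\<Sum>i\<in>V - S. w i * y)"
      using S finV by (subst sum.subset_diff[of S V]) (auto intro!: arg_cong2[of _ _ _ _ "(+)"] sum.cong)
    then show ?thesis by (simp add: a_def b_def wt_def sum_distrib_right)
  qed
  have "(\<Sum>i\<in>V. w i * v i k) = 0" for k
    using split[of "s * b" "- s * a"] unfolding v_def h_def by (cases "k = 0") auto
  moreover have "(\<Sum>i\<in>V. w i * sqnorm ?n (v i)) = 1"
  proof -
    have "(\<Sum>i\<in>V. w i * sqnorm ?n (v i)) = (\<Sum>i\<in>V. w i * (if i \<in> S then (s * b)\<^sup>2 else (s * a)\<^sup>2))"
      unfolding norm h_def by (intro sum.cong) auto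
    also have "\<dots> = s\<^sup>2 * (a * b * (a + b))"
      unfolding split by (simp add: power2_eq_square algebra_simps)
    finally show ?thesis using s2 by simp
  qed
  \<comment> \<open>With only two values, \<open>j\<close> differs from \<open>i\<close> or
    \<open>k\<close> whenever those differ, and all nonzero distances are equal.\<close>
  moreover have "sqdist ?n (v i) (v k) \<le> sqdist ?n (v i) (v j) + sqdist ?n (v j) (v k)" for i j k
    unfolding dist h_def by auto
  ultimately have emb: "v \<in> embeddings V w" by (simp add: embeddings_def)
  have "flow_energy V E F v \<le> 2 * psi_set V E w S" if F: "F \<in> flows_v V E w" for F
  proof -
    let ?X = "\<lambda>A B. \<Sum>i\<in>A. \<Sum>j\<in>B. if (i, j) \<in> E then F (i, j) else 0"
    let ?D = "(s * (a + b))\<^sup>2"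
    let ?m = "min (wt w (out_bd V E S)) (wt w (out_bd V E (V - S)))"
    have SV: "S \<subseteq> V" using S by simp
    define g where "g i j = (if (i, j) \<in> E then F (i, j) * (h i - h j)\<^sup>2 else 0)" for i j
    have sp: "(\<Sum>j\<in>V. f j) = (\<Sum>j\<in>S. f j) + (\<Sum>j\<in>V - S. f j)" for f :: "nat \<Rightarrow> real"
      using SV finV by (simp add: sum.subset_diff)
    have "(\<Sum>(i, j)\<in>E. F (i, j) * sqdist ?n (v i) (v j)) = (\<Sum>i\<in>V. \<Sum>j\<in>V. g i j)"
      unfolding dist g_def sum_arcs(1)[OF finV EV] by (simp cong: if_cong)
    also have "\<dots> = (\<Sum>i\<in>S. \<Sum>j\<in>S. g i j) + (\<Sum>i\<in>S. \<Sum>j\<in>V - S. g i j)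
       + ((\<Sum>i\<in>V - S. \<Sum>j\<in>S. g i j) + (\<Sum>i\<in>V - S. \<Sum>j\<in>V - S. g i j))"
      unfolding sp by (simp add: sum.distrib)
    also have "(\<Sum>i\<in>S. \<Sum>j\<in>S. g i j) = 0" by (intro sum.neutral ballI) (simp add: g_def h_def)
    also have "(\<Sum>i\<in>V - S. \<Sum>j\<in>V - S. g i j) = 0" by (intro sum.neutral ballI) (simp add: g_def h_def)
    also have "(\<Sum>i\<in>S. \<Sum>j\<in>V - S. g i j) = ?D * ?X S (V - S)"
      unfolding sum_distrib_left g_def h_def
      by (intro sum.cong refl) (auto simp: algebra_simps)
    also have "(\<Sum>i\<in>V - S. \<Sum>j\<in>S. g i j) = ?D * ?X (V - S) S"
    proof -
      have "(- s * a - s * b)\<^sup>2 = ?D" by (simp add: power2_eq_square algebra_simps)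
      then show ?thesis unfolding sum_distrib_left g_def h_def
        by (intro sum.cong refl) (auto simp: mult.commute)
    qed
    \<comment> \<open>Both crossing directions contribute equally, which absorbs the factor
      1/2.\<close>
    finally have "flow_energy V E F v = ?D * ?X S (V - S)"
      unfolding flow_energy_def flow_across_cut(1)[OF F SV] by simp
    also have "\<dots> \<le> ?D * ?m" by (intro mult_left_mono flow_across_cut(2)[OF F SV]) simp
    also have "?D = (a + b) / (a * b)"
    proof -
      have "?D * (a * b) = (a + b) * (s\<^sup>2 * (a * b * (a + b)))" by (simp add: power2_eq_square algebra_simps)
      then show ?thesis using ab s2 by (simp add: eq_divide_eq)
    qed
    also have "(a + b) / (a * b) * ?m \<le> 2 / min a b * ?m"
    proof (intro mult_right_mono)
      \<comment> \<open>Since \<open>a + b\<close> is at most twice the maximum; this is the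
        constant 2 of the lower bound.\<close>
      show "(a + b) / (a * b) \<le> 2 / min a b"
        using ab by (auto simp: min_def field_simps)
      show "0 \<le> ?m" using wt_nonneg[OF out_bd_subset] by simp
    qed
    also have "\<dots> = 2 * psi_set V E w S" by (simp add: psi_set_def a_def b_def)
    finally show ?thesis .
  qed
  then have "(SUP F\<in>flows_v V E w. flow_energy V E F v) \<le> 2 * psi_set V E w S"
    using flows_nonempty by (intro cSUP_least) auto
  then show ?thesis using emb by blast
qed

lemma lambda_le: "lambda_v V E w \<le> 2 * psi_graph V E w"
proof -
  have "psi_graph V E w \<in> psi_set V E w ` cuts"
    unfolding psi_graph_def using cuts by (intro Min_in) auto
  then obtain S where S: "S \<in> cuts" "psi_graph V E w = psi_set V E w S" by auto
  obtain v where "v \<in> embeddings V w" "(SUP F\<in>flows_v V E w. flow_energy V E F v) \<le> 2 * psi_set V E w S"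
    using cut_embedding[OF S(1)] by blast
  then show ?thesis unfolding lambda_v_def S(2)
    by (intro cINF_lower2[where x = v]) (auto intro!: bdd_belowI2[where m = 0] SUP_energy_nonneg)
qed

section \<open>Rounding an embedding to a cut\<close>

text \<open>Duality replaces the best flow by \<open>r\<close> and \<open>p\<close>,
  \<open>spread\<close> supplies \<open>A\<close> and \<open>\<delta>\<close> for the same
  embedding, and \<open>potential_sweep\<close> compares the two.\<close>

lemma psi_le_energy:
  assumes v: "v \<in> embeddings V w"
  shows "psi_graph V E w \<le> 2 ^ 63 * sqrt (ln (card V)) * (SUP F\<in>flows_v V E w. flow_energy V E F v)"
proof -
  define M where "M = (SUP F\<in>flows_v V E w. flow_energy V E F v)"
  define W where "W = wt w V"
  let ?n = "card V" and ?\<psi> = "psi_graph V E w"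
  let ?L = "sqrt (ln (card V))"
  have W: "W > 0" unfolding W_def using wt_pos[of V] cardV by (cases "V = {}") auto
  have v_center: "\<And>k. k < ?n \<Longrightarrow> (\<Sum>i\<in>V. w i * v i k) = 0"
    and v_norm: "(\<Sum>i\<in>V. w i * sqnorm ?n (v i)) = 1"
    and v_tri: "\<And>i j k. \<lbrakk>i \<in> V; j \<in> V; k \<in> V\<rbrakk> \<Longrightarrow>
      sqdist ?n (v i) (v k) \<le> sqdist ?n (v i) (v j) + sqdist ?n (v j) (v k)"
    using v unfolding embeddings_def Let_def by auto
  have "\<exists>r p. (\<forall>j\<in>V. 0 \<le> r j) \<and> (\<forall>(i, j)\<in>E. sqdist ?n (v i) (v j) / 2 + p j - p i \<le> r j)
      \<and> (\<Sum>j\<in>V. w j * r j) \<le> M"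
  proof (rule circulation_duality[OF finV EV])
    fix F assume F: "F \<in> flows_v V E w"
    have "flow_energy V E F v \<le> M" unfolding M_def using F by (intro cSUP_upper energy_bdd)
    then show "(\<Sum>(i, j)\<in>E. F (i, j) * (sqdist ?n (v i) (v j) / 2)) \<le> M"
      by (simp add: flow_energy_def case_prod_beta sum_divide_distrib)
  qed (simp add: less_imp_le w_pos)
  then obtain r p where r: "\<forall>j\<in>V. 0 \<le> r j" "\<forall>(i, j)\<in>E. sqdist ?n (v i) (v j) / 2 + p j - p i \<le> r j"
    "(\<Sum>j\<in>V. w j * r j) \<le> M"
    by (elim exE conjE)
  \<comment> \<open>Passing to probability weights divides the second moment by \<open>W\<close>;
    the factor \<open>sqrt W\<close> restores it to 1.\<close>
  define u where "u i k = sqrt W * v i k" for i k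
  define P where "P i = w i / W" for i
  have sq_u: "sqnorm ?n (u i) = W * sqnorm ?n (v i)" for i
    using W by (simp add: sqnorm_def u_def power_mult_distrib sum_distrib_left)
  have dist_u: "sqdist ?n (u i) (u j) = W * sqdist ?n (v i) (v j)" for i j
    using W by (simp add: sqdist_def u_def right_diff_distrib[symmetric] power_mult_distrib sum_distrib_left)
  interpret l2_squared_metric V P ?n u
  proof
    show "(\<Sum>i\<in>V. P i) = 1" using W by (simp add: P_def sum_divide_distrib[symmetric] W_def wt_def)
    show "sqdist ?n (u i) (u k) \<le> sqdist ?n (u i) (u j) + sqdist ?n (u j) (u k)"
      if "i \<in> V" "j \<in> V" "k \<in> V" for i j k
      using v_tri[OF that] W unfolding dist_u distrib_left[symmetric] by simp
  qed (use finV w_pos W in \<open>auto simp: P_def less_imp_le\<close>)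
  have center: "(\<Sum>i\<in>V. P i * u i k) = 0" if "k < ?n" for k
  proof -
    have "(\<Sum>i\<in>V. P i * u i k) = (sqrt W / W) * (\<Sum>i\<in>V. w i * v i k)"
      by (simp add: P_def u_def sum_distrib_left mult_ac)
    then show ?thesis using v_center[OF that] by simp
  qed
  have "(\<Sum>i\<in>V. P i * sqnorm ?n (u i)) = 1"
    using W v_norm by (simp add: P_def sq_u)
  note spreading = spread[OF _ this cardV]
  obtain A \<delta> where A: "A \<subseteq> V" "\<forall>j\<in>V. 0 \<le> \<delta> j"
    "\<forall>i\<in>A. \<forall>j\<in>V. \<delta> j \<le> sqdist ?n (u i) (u j)"
    "1 / 2 ^ 60 \<le> ?L * (sum P A * (\<Sum>j\<in>V. P j * \<delta> j))"
    using center by (elim exE[OF spreading] exE conjE)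
  have L: "?L \<ge> 0" using cardV by simp
  \<comment> \<open>Dividing \<open>\<delta>\<close> by \<open>2 * W\<close> undoes this scaling and
    matches the half distances used in the duality.\<close>
  have swept: "?\<psi> * wt w A * (\<Sum>j\<in>V. w j * (\<delta> j / (2 * W))) \<le> 4 * wt w V * (\<Sum>j\<in>V. w j * r j)"
  proof (rule potential_sweep)
    show "sqdist ?n (v i) (v k) / 2 \<le> sqdist ?n (v i) (v j) / 2 + sqdist ?n (v j) (v k) / 2"
      if "i \<in> V" "j \<in> V" "k \<in> V" for i j k using v_tri[OF that] by simp
    show "\<delta> j / (2 * W) \<le> sqdist ?n (v i) (v j) / 2" if "i \<in> A" "j \<in> V" for i j
      using A(3) that W by (simp add: dist_u divide_le_eq mult.commute)
    show "sqdist ?n (v i) (v j) / 2 + p j - p i \<le> r j" if "(i, j) \<in> E" for i j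
      using r(2) that by auto
  qed (use A r W in \<open>auto simp: sqdist_commute\<close>)
  have \<delta>_sum: "(\<Sum>j\<in>V. w j * (\<delta> j / (2 * W))) = (\<Sum>j\<in>V. P j * \<delta> j) / 2"
    by (simp add: P_def sum_divide_distrib mult.commute[of 2 W])
  have A_wt: "wt w A = W * sum P A"
    using W by (simp add: P_def wt_def sum_divide_distrib[symmetric])
  have "4 * wt w V * (\<Sum>j\<in>V. w j * r j) \<le> 4 * W * M"
    using r(3) W by (simp add: W_def)
  from order_trans[OF swept this]
  have "?\<psi> * (W * sum P A) * ((\<Sum>j\<in>V. P j * \<delta> j) / 2) \<le> 4 * W * M"
    unfolding \<delta>_sum A_wt .
  then have "W * (?\<psi> * (sum P A * (\<Sum>j\<in>V. P j * \<delta> j))) \<le> W * (8 * M)" by (simp add: algebra_simps)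
  then have key: "?\<psi> * (sum P A * (\<Sum>j\<in>V. P j * \<delta> j)) \<le> 8 * M" using W by simp
  \<comment> \<open>The factor 8 of \<open>key\<close> times \<open>2 ^ 60\<close> gives
    \<open>2 ^ 63\<close>.\<close>
  have "?\<psi> * (1 / 2 ^ 60) \<le> ?\<psi> * (?L * (sum P A * (\<Sum>j\<in>V. P j * \<delta> j)))"
    by (rule mult_left_mono[OF A(4) psi_graph_nonneg])
  also have "\<dots> = ?L * (?\<psi> * (sum P A * (\<Sum>j\<in>V. P j * \<delta> j)))" by (simp add: mult_ac)
  also have "\<dots> \<le> ?L * (8 * M)" by (rule mult_left_mono[OF key L])
  finally show ?thesis unfolding M_def[symmetric] by (simp add: mult_ac)
qed

lemma psi_le_lambda: "psi_graph V E w \<le> 2 ^ 63 * sqrt (ln (card V)) * lambda_v V E w"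
proof -
  let ?c = "2 ^ 63 * sqrt (ln (card V))"
  have c: "?c > 0" using cardV by simp
  \<comment> \<open>Bounding the infimum from below requires a nonempty set of embeddings, which any
    cut supplies.\<close>
  obtain S where "S \<in> cuts" using cuts by blast
  then have "embeddings V w \<noteq> {}" using cut_embedding by blast
  then have "psi_graph V E w / ?c \<le> lambda_v V E w"
    unfolding lambda_v_def using psi_le_energy c
    by (intro cINF_greatest) (auto simp: divide_le_eq mult.commute)
  then show ?thesis using c by (simp add: divide_le_eq mult.commute)
qed

end

theorem mainTheorem13:
  shows "\<exists>C1 C2 :: real. C1 > 0 \<and> C2 > 0 \<and>
    (\<forall>(V :: nat set) (E :: (nat \<times> nat) set) (w :: nat \<Rightarrow> real).
       finite V \<and> card V \<ge> 2 \<and> E \<subseteq> V \<times> V \<and> (\<forall>i\<in>V. w i > 0) \<longrightarrow>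
         lambda_v V E w \<le> C1 * psi_graph V E w \<and>
         psi_graph V E w \<le> C2 * sqrt (ln (real (card V))) * lambda_v V E w)"
proof (rule exI[of _ 2], rule exI[of _ "2 ^ 63"], intro conjI allI impI)
  fix V :: "nat set" and E :: "(nat \<times> nat) set" and w :: "nat \<Rightarrow> real"
  assume "finite V \<and> card V \<ge> 2 \<and> E \<subseteq> V \<times> V \<and> (\<forall>i\<in>V. w i > 0)"
  then interpret weighted_digraph V E w by unfold_locales auto
  show "lambda_v V E w \<le> 2 * psi_graph V E w" by (rule lambda_le)
  show "psi_graph V E w \<le> 2 ^ 63 * sqrt (ln (real (card V))) * lambda_v V E w"
    by (rule psi_le_lambda)
qed auto

end
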